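(* Abelian automorphism groups of smooth cubic fourfolds which are conjugate to subgroups of $\mathcal P_6\subset PGL(6)=\mathrm{Aut}(\mathbb P^5)$ are either diagonalizable, or conjugate to subgroups of $D_3\otimes\mathcal P_2$, or conjugate to subgroups of $D_2\otimes\mathcal P_3$, or conjugate to the subgroup of $\mathcal P_6\subset PGL(6)$, abstractly isomorphic to $\mathbb Z/3\mathbb Z\oplus\mathbb Z/6\mathbb Z$, which is generated by the matrices $W_6^2$ and $P_6\cdot W_6^i$ for some $i\in\{0,1\}$.
   Context: The base field is $\mathbb C$. A finite subgroup $G\subset PGL(6)$ is an automorphism group of a smooth cubic fourfold if there is a smooth cubic hypersurface $X\subset\mathbb P^5$ with $g(X)\subset X$ for all $g\in G$. It is diagonalizable if the inclusion $G\hookrightarrow PGL(6)$ factors through a homomorphism $G\to GL(6)$; for finite abelian $G$ this means that $G$ is conjugate to a group of classes of diagonal matrices. For $n\ge 2$ the Pauli subgroup $\mathcal P_n\subset PGL(n)$ is generated by the classes of the $n\times n$ matrices $P_n$ (the cyclic permutation matrix with entries $1$ in positions $(k,k+1)$, $1\le k\le n-1$, and $(n,1)$, and $0$ elsewhere) and $W_n=\mathrm{diag}(1,\omega_n,\omega_n^2,\dots,\omega_n^{n-1})$, $\omega_n=e^{2\pi i/n}$; it is isomorphic to $\mathbb Z/n\mathbb Z\oplus\mathbb Z/n\mathbb Z$. $D_n\subset PGL(n)$ is the subgroup of classes of diagonal matrices. $D_k\otimes\mathcal P_l\subset PGL(kl)$ is the group of classes of tensor (Kronecker) products $A\otimes B$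 with $A$ representing an element of $D_k$ and $B$ representing an element of $\mathcal P_l$. *)

theory Defs
  imports
    Complex_Main
    "HOL-Library.Poly_Mapping"
    "HOL-Algebra.Coset"
    "HOL-Algebra.Generated_Groups"
    "HOL-Algebra.Elementary_Groups"
    "Jordan_Normal_Form.Matrix"
begin

definition GL :: "nat \<Rightarrow> complex mat monoid" where
  "GL n = units_of (ring_mat TYPE(complex) n ())"

definition scalars :: "nat \<Rightarrow> complex mat set" where
  "scalars n = {c \<cdot>\<^sub>m 1\<^sub>m n | c. c \<noteq> 0}"

definition PGL :: "nat \<Rightarrow> complex mat set monoid" where
  "PGL n = GL n Mod scalars n"

definition pgl_class :: "nat \<Rightarrow> complex mat \<Rightarrow> complex mat set" where
  "pgl_class n A = scalars n #>\<^bsub>GL n\<^esub> A"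

definition conjugate_in :: "('a, 'b) monoid_scheme \<Rightarrow> 'a set \<Rightarrow> 'a set \<Rightarrow> bool" where
  "conjugate_in \<Gamma> H K \<longleftrightarrow>
     (\<exists>g \<in> carrier \<Gamma>. K = (\<lambda>h. g \<otimes>\<^bsub>\<Gamma>\<^esub> h \<otimes>\<^bsub>\<Gamma>\<^esub> inv\<^bsub>\<Gamma>\<^esub> g) ` H)"

definition conjugate_to_subgroup_of :: "('a, 'b) monoid_scheme \<Rightarrow> 'a set \<Rightarrow> 'a set \<Rightarrow> bool" where
  "conjugate_to_subgroup_of \<Gamma> H S \<longleftrightarrow>
     (\<exists>K. subgroup K \<Gamma> \<and> K \<subseteq> S \<and> conjugate_in \<Gamma> H K)"

text \<open>For finite abelian \<open>G\<close>, a lift of the inclusion to GL(n) exists iff \<open>G\<close> is conjugate to a group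
  of classes of diagonal matrices.\<close>

definition diagonalizable :: "nat \<Rightarrow> complex mat set set \<Rightarrow> bool" where
  "diagonalizable n G \<longleftrightarrow>
     (\<exists>\<phi> \<in> hom ((PGL n)\<lparr>carrier := G\<rparr>) (GL n). \<forall>g \<in> G. pgl_class n (\<phi> g) = g)"

text \<open>Matrix indices start at 0.\<close>

definition P_mat :: "nat \<Rightarrow> complex mat" where
  "P_mat n = mat n n (\<lambda>(i, j). if j = (i + 1) mod n then 1 else 0)"

definition W_mat :: "nat \<Rightarrow> complex mat" where
  "W_mat n = mat n n (\<lambda>(i, j). if i = j then exp (2 * of_real pi * \<i> / of_nat n) ^ i else 0)"

definition pauli :: "nat \<Rightarrow> complex mat set set" where
  "pauli n = generate (PGL n) {pgl_class n (P_mat n), pgl_class n (W_mat n)}"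

definition diag_group :: "nat \<Rightarrow> complex mat set set" where
  "diag_group n = {pgl_class n A | A. A \<in> carrier (GL n) \<and> diagonal_mat A}"

definition kronecker :: "complex mat \<Rightarrow> complex mat \<Rightarrow> complex mat" where
  "kronecker A B = mat (dim_row A * dim_row B) (dim_col A * dim_col B)
     (\<lambda>(i, j). A $$ (i div dim_row B, j div dim_col B) * B $$ (i mod dim_row B, j mod dim_col B))"

definition tensor_group ::
    "nat \<Rightarrow> nat \<Rightarrow> complex mat set set \<Rightarrow> complex mat set set \<Rightarrow> complex mat set set" where
  "tensor_group k l S T =
     {pgl_class (k * l) (kronecker A B) | A B.
        A \<in> carrier (GL k) \<and> pgl_class k A \<in> S \<and> B \<in> carrier (GL l) \<and> pgl_class l B \<in> T}"

definition pauli_subgroup_36 :: "nat \<Rightarrow> complex mat set set" where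
  "pauli_subgroup_36 i =
     generate (PGL 6) {pgl_class 6 (W_mat 6 ^\<^sub>m 2), pgl_class 6 (P_mat 6 * W_mat 6 ^\<^sub>m i)}"

text \<open>Polynomials over the complex numbers in the variables \<open>x\<^sub>0, x\<^sub>1, \<dots>\<close>: coefficients are
  indexed by monomials, and a monomial is its finitely supported exponent function.\<close>

type_synonym cpoly = "(nat \<Rightarrow>\<^sub>0 nat) \<Rightarrow>\<^sub>0 complex"

definition homogeneous_form :: "nat \<Rightarrow> nat \<Rightarrow> cpoly \<Rightarrow> bool" where
  "homogeneous_form n d F \<longleftrightarrow>
     (\<forall>m \<in> Poly_Mapping.keys F. Poly_Mapping.keys m \<subseteq> {..<n} \<and>
        (\<Sum>i \<in> Poly_Mapping.keys m. Poly_Mapping.lookup m i) = d)"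

definition eval_cpoly :: "cpoly \<Rightarrow> complex vec \<Rightarrow> complex" where
  "eval_cpoly F v = (\<Sum>m \<in> Poly_Mapping.keys F. Poly_Mapping.lookup F m *
     (\<Prod>i \<in> Poly_Mapping.keys m. (v $ i) ^ Poly_Mapping.lookup m i))"

text \<open>The formal partial derivative; monomials not containing \<open>x\<^sub>i\<close> contribute 0 because of the
  factor \<open>lookup m i\<close>, so the truncated subtraction of exponents does no harm.\<close>

definition partial_deriv :: "nat \<Rightarrow> cpoly \<Rightarrow> cpoly" where
  "partial_deriv i F = (\<Sum>m \<in> Poly_Mapping.keys F.
     Poly_Mapping.single (m - Poly_Mapping.single i 1)
       (of_nat (Poly_Mapping.lookup m i) * Poly_Mapping.lookup F m))"

text \<open>A point of projective (n-1)-space is the set of its homogeneous coordinate vectors.\<close>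

definition proj_point :: "complex vec \<Rightarrow> complex vec set" where
  "proj_point v = {c \<cdot>\<^sub>v v | c. c \<noteq> 0}"

definition proj_zeros :: "nat \<Rightarrow> cpoly \<Rightarrow> complex vec set set" where
  "proj_zeros n F = {proj_point v | v. v \<in> carrier_vec n \<and> v \<noteq> 0\<^sub>v n \<and> eval_cpoly F v = 0}"

text \<open>Smoothness is the Jacobian criterion.\<close>

definition smooth_form :: "nat \<Rightarrow> cpoly \<Rightarrow> bool" where
  "smooth_form n F \<longleftrightarrow>
     (\<forall>v \<in> carrier_vec n. v \<noteq> 0\<^sub>v n \<and> eval_cpoly F v = 0 \<longrightarrow>
        (\<exists>i < n. eval_cpoly (partial_deriv i F) v \<noteq> 0))"

text \<open>Ambient projective space has dimension \<open>n - 1\<close>, so cubic fourfolds are the case \<open>n = 6\<close>.\<close>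

definition smooth_cubic_hypersurface :: "nat \<Rightarrow> complex vec set set \<Rightarrow> bool" where
  "smooth_cubic_hypersurface n X \<longleftrightarrow>
     (\<exists>F. F \<noteq> 0 \<and> homogeneous_form n 3 F \<and> smooth_form n F \<and> X = proj_zeros n F)"

definition pgl_act :: "complex mat set \<Rightarrow> complex vec set \<Rightarrow> complex vec set" where
  "pgl_act g p = {A *\<^sub>v v | A v. A \<in> g \<and> v \<in> p}"

definition cubic_fourfold_automorphism_group :: "complex mat set set \<Rightarrow> bool" where
  "cubic_fourfold_automorphism_group G \<longleftrightarrow>
     subgroup G (PGL 6) \<and> finite G \<and>
     (\<exists>X. smooth_cubic_hypersurface 6 X \<and> (\<forall>g \<in> G. pgl_act g ` X \<subseteq> X))"

end

theory Submission
  imports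
    Defs
    "HOL-Computational_Algebra.Fundamental_Theorem_Algebra"
    "HOL-Number_Theory.Cong"
begin

text \<open>
  Let \<open>F\<close> be the equation of the cubic \<open>X\<close>, and let \<open>\<omega>\<close> be a primitive sixth root of unity.
  Up to conjugacy the elements of \<open>G\<close> are classes of the monomial matrices \<open>P\<^sup>a W\<^sup>b\<close>
  (\<open>weyl_mat 6 a b\<close>), and two such matrices \<open>M = P\<^sup>a W\<^sup>b\<close> and \<open>N = P\<^sup>c W\<^sup>d\<close> satisfy
  \<open>M N = \<omega>\<^sup>e N M\<close> with \<open>e = a d - b c\<close>.

  A matrix \<open>A\<close> whose class preserves \<open>X\<close> multiplies \<open>F\<close> by a nonzero scalar
  (\<open>smooth_cubic_semi_invariant\<close>). Since \<open>F\<close> has degree 3, applying \<open>M N\<close> and \<open>\<omega>\<^sup>e N M\<close> to it shows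
  \<open>\<omega>\<^sup>3\<^sup>e = 1\<close>, that is, \<open>e\<close> is even (\<open>pauli_6_commutation_parity\<close>). On the other hand the Chinese
  remainder theorem identifies \<open>P\<^sub>6\<close> with \<open>P\<^sub>2 \<otimes> P\<^sub>3\<close> and \<open>W\<^sub>6\<close> with \<open>W\<^sub>2 \<otimes> W\<^sub>3\<^sup>2\<close> (\<open>crt_mat_weyl\<close>).
  Evenness of all the \<open>e\<close> says exactly that the \<open>2 \<times> 2\<close> tensor factors of the elements of \<open>G\<close>
  commute, so one change of basis diagonalizes them all, and \<open>G\<close> is conjugate to a subgroup of
  \<open>D\<^sub>2 \<otimes> \<P>\<^sub>3\<close> (\<open>weyl_tensor_form\<close>). This includes the two subgroups of type (3, 6), whose structure is
  read off from the normal form \<open>P\<^sup>a W\<^sup>b\<close> of the elements of the Pauli group.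

  Semi-invariance is the geometric point. It is usually deduced from irreducibility of \<open>F\<close> and the
  Nullstellensatz; here it comes from restricting to lines. Fix \<open>b\<close> with \<open>F b \<noteq> 0\<close>. If the cubic
  polynomial \<open>t \<mapsto> F (a + t b)\<close> has three distinct roots, which are also roots of \<open>t \<mapsto> F (A (a + t b))\<close>,
  then the two polynomials are proportional with a factor that depends only on \<open>b\<close>. It is enough
  to let \<open>a\<close> vary in a hyperplane where this cubic is depressed. The good points \<open>a\<close> are those where its
  discriminant does not vanish; if there is one at all, then almost every point of any line through it
  in the hyperplane is good, which suffices. If there were none, then a nontrivial common zero of the
  two coefficients of the depressed cubic would be a singular point of \<open>X\<close>
  (\<open>smooth_cubic_nondegenerate_line\<close>).
\<close>

section \<open>Cubic forms restricted to lines\<close>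

definition monom_val :: "complex vec \<Rightarrow> (nat \<Rightarrow>\<^sub>0 nat) \<Rightarrow> complex" where
  "monom_val v m = (\<Prod>i \<in> Poly_Mapping.keys m. (v $ i) ^ Poly_Mapping.lookup m i)"

lemma monom_val_superset:
  assumes "finite I" "Poly_Mapping.keys m \<subseteq> I"
  shows "monom_val v m = (\<Prod>i\<in>I. (v $ i) ^ Poly_Mapping.lookup m i)"
  unfolding monom_val_def
  by (rule prod.mono_neutral_left) (use assms in \<open>auto simp: in_keys_iff\<close>)

lemma monom_val_add: "monom_val v (m + m') = monom_val v m * monom_val v m'"
proof -
  let ?I = "Poly_Mapping.keys m \<union> Poly_Mapping.keys m'"
  have "monom_val v (m + m') = (\<Prod>i\<in>?I. (v $ i) ^ Poly_Mapping.lookup (m + m') i)"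
    by (rule monom_val_superset) (use Poly_Mapping.keys_add[of m m'] in auto)
  also have "\<dots> = monom_val v m * monom_val v m'"
    by (simp add: monom_val_superset[of ?I] lookup_add power_add prod.distrib)
  finally show ?thesis .
qed

lemma monom_val_single: "monom_val v (Poly_Mapping.single i (Suc 0)) = v $ i"
  by (simp add: monom_val_def)

lemma eval_cpoly_superset:
  assumes "finite S" "Poly_Mapping.keys F \<subseteq> S"
  shows "eval_cpoly F v = (\<Sum>m\<in>S. Poly_Mapping.lookup F m * monom_val v m)"
  unfolding eval_cpoly_def monom_val_def[symmetric]
  by (rule sum.mono_neutral_left) (use assms in \<open>auto simp: in_keys_iff\<close>)

lemma eval_cpoly_add: "eval_cpoly (F + G) v = eval_cpoly F v + eval_cpoly G v"
proof -
  let ?S = "Poly_Mapping.keys F \<union> Poly_Mapping.keys G"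
  have "eval_cpoly (F + G) v = (\<Sum>m\<in>?S. Poly_Mapping.lookup (F + G) m * monom_val v m)"
    by (rule eval_cpoly_superset) (use Poly_Mapping.keys_add[of F G] in auto)
  also have "\<dots> = eval_cpoly F v + eval_cpoly G v"
    by (simp add: eval_cpoly_superset[of ?S] lookup_add distrib_right sum.distrib)
  finally show ?thesis .
qed

lemma eval_cpoly_single: "eval_cpoly (Poly_Mapping.single m c) v = c * monom_val v m"
  by (simp add: eval_cpoly_def monom_val_def)

lemma eval_cpoly_sum:
  "finite S \<Longrightarrow> eval_cpoly (\<Sum>m\<in>S. g m) v = (\<Sum>m\<in>S. eval_cpoly (g m) v)"
proof (induction S rule: finite_induct)
  case empty
  then show ?case by (simp add: eval_cpoly_def)
next
  case (insert x S)
  then show ?case by (simp add: eval_cpoly_add)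
qed

lemma eval_partial_deriv:
  "eval_cpoly (partial_deriv i F) v = (\<Sum>m\<in>Poly_Mapping.keys F.
     Poly_Mapping.lookup F m * (of_nat (Poly_Mapping.lookup m i) *
       monom_val v (m - Poly_Mapping.single i (Suc 0))))"
  by (simp add: partial_deriv_def eval_cpoly_sum eval_cpoly_single mult_ac)

definition monom_deriv :: "nat \<Rightarrow> complex vec \<Rightarrow> complex vec \<Rightarrow> (nat \<Rightarrow>\<^sub>0 nat) \<Rightarrow> complex" where
  "monom_deriv n v w m = (\<Sum>i<n. w $ i * (of_nat (Poly_Mapping.lookup m i) *
       monom_val v (m - Poly_Mapping.single i (Suc 0))))"

text \<open>
  The Leibniz rule. The power \<open>m - single i 1\<close> is truncated when \<open>x\<^sub>i\<close> does not occur in \<open>m\<close>, but then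
  the factor \<open>lookup m i\<close> is zero.
\<close>

lemma monom_deriv_add:
  "monom_deriv n v w (m + m') =
     monom_deriv n v w m * monom_val v m' + monom_val v m * monom_deriv n v w m'"
proof -
  have *: "of_nat (Poly_Mapping.lookup k i) * monom_val v (k + k' - Poly_Mapping.single i (Suc 0))
      = of_nat (Poly_Mapping.lookup k i) * monom_val v (k - Poly_Mapping.single i (Suc 0))
        * monom_val v k'" for k k' :: "nat \<Rightarrow>\<^sub>0 nat" and i
  proof (cases "Poly_Mapping.lookup k i = 0")
    case False
    have "k + k' - Poly_Mapping.single i (Suc 0) = (k - Poly_Mapping.single i (Suc 0)) + k'"
      by (rule poly_mapping_eqI)
        (use False in \<open>auto simp: lookup_add lookup_minus lookup_single when_def\<close>)
    then show ?thesis by (simp add: monom_val_add)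
  qed auto
  have "w $ i * (of_nat (Poly_Mapping.lookup (m + m') i) *
       monom_val v (m + m' - Poly_Mapping.single i (Suc 0))) =
     w $ i * (of_nat (Poly_Mapping.lookup m i) *
       monom_val v (m - Poly_Mapping.single i (Suc 0))) * monom_val v m' +
     monom_val v m * (w $ i * (of_nat (Poly_Mapping.lookup m' i) *
       monom_val v (m' - Poly_Mapping.single i (Suc 0))))" for i
    using *[of m' i m] unfolding add.commute[of m' m]
    by (simp only: lookup_add of_nat_add distrib_right distrib_left *[of m i m'] mult_ac)
  then show ?thesis
    by (simp add: monom_deriv_def sum.distrib sum_distrib_left sum_distrib_right)
qed

lemma monom_deriv_single:
  "i < n \<Longrightarrow> monom_deriv n v w (Poly_Mapping.single i (Suc 0)) = w $ i"
  by (simp add: monom_deriv_def lookup_single when_def if_distrib if_distribR monom_val_def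
      cong: if_cong)

text \<open>
  Used three times, this writes a monomial of degree 3 as a product of three variables, for which
  identities can be checked by expanding.
\<close>

lemma monomial_of_degree_Suc:
  fixes m :: "nat \<Rightarrow>\<^sub>0 nat"
  assumes "Poly_Mapping.keys m \<subseteq> {..<n}"
    and "(\<Sum>i\<in>Poly_Mapping.keys m. Poly_Mapping.lookup m i) = Suc d"
  obtains i :: nat and m' where "i < n" "m = Poly_Mapping.single i (Suc 0) + m'"
    "Poly_Mapping.keys m' \<subseteq> {..<n}"
    "(\<Sum>i\<in>Poly_Mapping.keys m'. Poly_Mapping.lookup m' i) = d"
proof -
  have deg: "(\<Sum>i\<in>Poly_Mapping.keys k. Poly_Mapping.lookup k i) = (\<Sum>i<n. Poly_Mapping.lookup k i)"
    if "Poly_Mapping.keys k \<subseteq> {..<n}" for k :: "nat \<Rightarrow>\<^sub>0 nat"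
    by (rule sum.mono_neutral_left) (use that in \<open>auto simp: in_keys_iff\<close>)
  from assms(2) obtain i where i: "i \<in> Poly_Mapping.keys m"
    by (metis all_not_in_conv nat.distinct(1) sum.empty)
  define m' where "m' = m - Poly_Mapping.single i (Suc 0)"
  have m: "m = Poly_Mapping.single i (Suc 0) + m'"
    by (rule poly_mapping_eqI)
      (use i in \<open>auto simp: m'_def lookup_add lookup_minus lookup_single when_def in_keys_iff\<close>)
  have keys: "Poly_Mapping.keys m' \<subseteq> {..<n}"
  proof
    fix x assume "x \<in> Poly_Mapping.keys m'"
    then have "x \<in> Poly_Mapping.keys m" by (auto simp: m'_def in_keys_iff lookup_minus)
    then show "x \<in> {..<n}" using assms(1) by auto
  qed
  have "i < n" using i assms(1) by auto
  have "Suc d = (\<Sum>j<n. Poly_Mapping.lookup m j)"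
    using assms deg by simp
  also have "\<dots> = Suc (\<Sum>j<n. Poly_Mapping.lookup m' j)"
    unfolding m using \<open>i < n\<close> by (simp add: lookup_add sum.distrib lookup_single when_def)
  finally show ?thesis
    using that[OF \<open>i < n\<close> m keys] deg[OF keys] by simp
qed

definition directional_deriv :: "nat \<Rightarrow> cpoly \<Rightarrow> complex vec \<Rightarrow> complex vec \<Rightarrow> complex" where
  "directional_deriv n F v w = (\<Sum>i<n. w $ i * eval_cpoly (partial_deriv i F) v)"

lemma directional_deriv_eq_sum:
  "directional_deriv n F v w =
     (\<Sum>m\<in>Poly_Mapping.keys F. Poly_Mapping.lookup F m * monom_deriv n v w m)"
  unfolding directional_deriv_def eval_partial_deriv monom_deriv_def sum_distrib_left
  by (subst sum.swap) (simp add: mult_ac)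

lemma directional_deriv_add:
  "w \<in> carrier_vec n \<Longrightarrow> w' \<in> carrier_vec n \<Longrightarrow>
   directional_deriv n F v (w + w') = directional_deriv n F v w + directional_deriv n F v w'"
  by (simp add: directional_deriv_def sum.distrib distrib_right)

lemma directional_deriv_smult:
  "w \<in> carrier_vec n \<Longrightarrow> directional_deriv n F v (c \<cdot>\<^sub>v w) = c * directional_deriv n F v w"
  by (simp add: directional_deriv_def sum_distrib_left mult_ac)

text \<open>
  The Taylor expansion along a line. By homogeneity the roles of \<open>v\<close> and \<open>w\<close> can be exchanged, so the
  coefficient of \<open>s\<^sup>2\<close> is again a first derivative. All polynomial identities for \<open>F\<close> that follow
  are consequences of this one.
\<close>

lemma cubic_on_line:
  assumes F: "homogeneous_form n 3 F" and v: "v \<in> carrier_vec n" and w: "w \<in> carrier_vec n"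
  shows "eval_cpoly F (v + s \<cdot>\<^sub>v w) = eval_cpoly F v + s * directional_deriv n F v w
     + s\<^sup>2 * directional_deriv n F w v + s ^ 3 * eval_cpoly F w"
proof -
  have "monom_val (v + s \<cdot>\<^sub>v w) m = monom_val v m + s * monom_deriv n v w m
     + s\<^sup>2 * monom_deriv n w v m + s ^ 3 * monom_val w m" if "m \<in> Poly_Mapping.keys F" for m
  proof -
    have m: "Poly_Mapping.keys m \<subseteq> {..<n}"
      "(\<Sum>i\<in>Poly_Mapping.keys m. Poly_Mapping.lookup m i) = Suc (Suc (Suc 0))"
      using F that by (auto simp: homogeneous_form_def)
    obtain i m1 where 1: "i < n" "m = Poly_Mapping.single i (Suc 0) + m1"
      "Poly_Mapping.keys m1 \<subseteq> {..<n}"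
      "(\<Sum>i\<in>Poly_Mapping.keys m1. Poly_Mapping.lookup m1 i) = Suc (Suc 0)"
      using monomial_of_degree_Suc[OF m] .
    obtain j m2 where 2: "j < n" "m1 = Poly_Mapping.single j (Suc 0) + m2"
      "Poly_Mapping.keys m2 \<subseteq> {..<n}"
      "(\<Sum>i\<in>Poly_Mapping.keys m2. Poly_Mapping.lookup m2 i) = Suc 0"
      using monomial_of_degree_Suc[OF 1(3,4)] .
    obtain k m3 where 3: "k < n" "m2 = Poly_Mapping.single k (Suc 0) + m3"
      "Poly_Mapping.keys m3 \<subseteq> {..<n}"
      "(\<Sum>i\<in>Poly_Mapping.keys m3. Poly_Mapping.lookup m3 i) = 0"
      using monomial_of_degree_Suc[OF 2(3,4)] .
    have "m3 = 0" using 3(4) by (auto simp: in_keys_iff intro!: poly_mapping_eqI)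
    then have "m = Poly_Mapping.single i (Suc 0) + (Poly_Mapping.single j (Suc 0)
        + Poly_Mapping.single k (Suc 0))"
      using 1 2 3 by simp
    then show ?thesis
      using v w 1(1) 2(1) 3(1)
      by (simp add: monom_val_add monom_deriv_add monom_val_single monom_deriv_single
          algebra_simps power2_eq_square power3_eq_cube)
  qed
  then show ?thesis
    by (simp add: directional_deriv_eq_sum eval_cpoly_def monom_val_def[symmetric]
        sum_distrib_left sum.distrib[symmetric] algebra_simps)
qed

lemma cubic_smult:
  assumes F: "homogeneous_form n 3 F" and v: "v \<in> carrier_vec n"
  shows "eval_cpoly F (c \<cdot>\<^sub>v v) = c ^ 3 * eval_cpoly F v"
proof -
  have "monom_val (c \<cdot>\<^sub>v v) m = c ^ 3 * monom_val v m" if "m \<in> Poly_Mapping.keys F" for m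
  proof -
    have m: "Poly_Mapping.keys m \<subseteq> {..<n}"
      "(\<Sum>i\<in>Poly_Mapping.keys m. Poly_Mapping.lookup m i) = 3"
      using F that by (auto simp: homogeneous_form_def)
    have "monom_val (c \<cdot>\<^sub>v v) m =
      (\<Prod>i\<in>Poly_Mapping.keys m. c ^ Poly_Mapping.lookup m i * (v $ i) ^ Poly_Mapping.lookup m i)"
      unfolding monom_val_def
      by (rule prod.cong) (use v m(1) in \<open>auto simp: power_mult_distrib\<close>)
    then show ?thesis using m(2) by (simp add: prod.distrib monom_val_def power_sum[symmetric])
  qed
  then show ?thesis
    by (simp add: eval_cpoly_def monom_val_def[symmetric] sum_distrib_left mult_ac)
qed

section \<open>Semi-invariance of smooth cubic forms\<close>

text \<open>
  The one-variable form of Zariski density: \<open>p q\<close> vanishes everywhere.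
\<close>

lemma poly_zero_if_zero_off_roots:
  fixes p q :: "complex poly"
  assumes "q \<noteq> 0" "\<And>s. poly q s \<noteq> 0 \<Longrightarrow> poly p s = 0"
  shows "poly p s = 0"
proof -
  have "poly (p * q) x = 0" for x using assms(2) by auto
  then have "p * q = 0" using poly_all_0_iff_0 by blast
  then show ?thesis using assms(1) by simp
qed

text \<open>
  The hypothesis is the discriminant of \<open>p t\<^sup>3 + q t + r\<close>, divided by \<open>- p\<close>. Two roots come from the
  fundamental theorem of algebra, and the third one is determined by the vanishing sum of the roots.
\<close>

lemma depressed_cubic_distinct_roots:
  fixes p q r :: complex
  assumes p: "p \<noteq> 0" and disc: "4 * q ^ 3 + 27 * p * r\<^sup>2 \<noteq> 0"
  obtains x y z where "x \<noteq> y" "x \<noteq> z" "y \<noteq> z"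
    "\<And>t. t \<in> {x, y, z} \<Longrightarrow> r + t * q + t ^ 3 * p = 0"
proof -
  have "\<exists>x. poly [:r, q, 0, p:] x = 0"
    by (rule fundamental_theorem_of_algebra) (use p in \<open>simp add: constant_degree\<close>)
  then obtain x where x: "r = - (x * q + x ^ 3 * p)"
    by (auto simp: algebra_simps power3_eq_cube eq_neg_iff_add_eq_0)
  have "\<exists>y. poly [:q + p * x\<^sup>2, p * x, p:] y = 0"
    by (rule fundamental_theorem_of_algebra) (use p in \<open>simp add: constant_degree\<close>)
  then obtain y where y: "q = - (p * (x\<^sup>2 + x * y + y\<^sup>2))"
    by (auto simp: algebra_simps power2_eq_square eq_neg_iff_add_eq_0)
  have r: "r = p * (x * y * (x + y))"
    unfolding x y by (simp add: algebra_simps power2_eq_square power3_eq_cube)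
  define z where "z = - x - y"
  have "4 * q ^ 3 + 27 * p * r\<^sup>2 = - (p ^ 3 * ((x - y) * (x - z) * (y - z))\<^sup>2)"
    unfolding r y z_def by (simp add: algebra_simps power2_eq_square power3_eq_cube)
  then have "(x - y) * (x - z) * (y - z) \<noteq> 0" using disc by auto
  then have "x \<noteq> y" "x \<noteq> z" "y \<noteq> z" by auto
  moreover have "r + t * q + t ^ 3 * p = 0" if "t \<in> {x, y, z}" for t
  proof -
    have "r + t * q + t ^ 3 * p = p * (t - x) * (t - y) * (t - z)"
      unfolding r y z_def by (simp add: algebra_simps power2_eq_square power3_eq_cube)
    then show ?thesis using that by auto
  qed
  ultimately show ?thesis using that by blast
qed

lemma quadratic_three_roots:
  fixes c0 c1 c2 :: complex
  assumes "x \<noteq> y" "x \<noteq> z" "y \<noteq> z"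
    and roots: "\<And>t. t \<in> {x, y, z} \<Longrightarrow> poly [:c0, c1, c2:] t = 0"
  shows "[:c0, c1, c2:] = 0"
proof (rule ccontr)
  assume nz: "[:c0, c1, c2:] \<noteq> 0"
  have "card {x, y, z} \<le> card {t. poly [:c0, c1, c2:] t = 0}"
    by (rule card_mono[OF poly_roots_finite[OF nz]]) (use roots in blast)
  also have "\<dots> \<le> degree [:c0, c1, c2:]"
    by (rule card_poly_roots_bound[OF nz])
  also have "\<dots> \<le> 2" by (simp add: degree_pCons_eq_if)
  finally show False using assms(1-3) by simp
qed

text \<open>
  For fixed \<open>b\<close> the derivative in direction \<open>b\<close> is a quadratic form; along a line it is a quadratic
  polynomial whose leading coefficient is the value at the direction of the line. It is obtained from
  the difference of \<open>F\<close> at \<open>x + b\<close> and \<open>x - b\<close>, to which the expansion along a line applies.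
\<close>

lemma directional_deriv_on_line:
  assumes F: "homogeneous_form n 3 F"
    and u: "u \<in> carrier_vec n" and w: "w \<in> carrier_vec n" and b: "b \<in> carrier_vec n"
  shows "directional_deriv n F (u + s \<cdot>\<^sub>v w) b = directional_deriv n F u b
    + s * ((directional_deriv n F (u + b) w - directional_deriv n F (u + (-1) \<cdot>\<^sub>v b) w) / 2)
    + s\<^sup>2 * directional_deriv n F w b"
proof -
  let ?f = "eval_cpoly F" and ?d = "directional_deriv n F"
  have diff: "?d x b = (?f (x + b) - ?f (x + (-1) \<cdot>\<^sub>v b)) / 2 - ?f b"
    if "x \<in> carrier_vec n" for x
    using cubic_on_line[OF F that b, of 1] cubic_on_line[OF F that b, of "-1"]
    by (simp add: field_simps)
  have [simp]: "u + s \<cdot>\<^sub>v w + c \<cdot>\<^sub>v b = (u + c \<cdot>\<^sub>v b) + s \<cdot>\<^sub>v w" for c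
    using u w b by (intro eq_vecI) auto
  have [simp]: "u + s \<cdot>\<^sub>v w + b = (u + b) + s \<cdot>\<^sub>v w"
    using u w b by (intro eq_vecI) auto
  have sq: "?d w (u + b) - ?d w (u + (-1) \<cdot>\<^sub>v b) = 2 * ?d w b"
    using u w b by (simp add: directional_deriv_add directional_deriv_smult)
  have "?d (u + s \<cdot>\<^sub>v w) b =
      (?f ((u + b) + s \<cdot>\<^sub>v w) - ?f ((u + (-1) \<cdot>\<^sub>v b) + s \<cdot>\<^sub>v w)) / 2 - ?f b"
    using u w b by (subst diff) auto
  also have "?f ((u + b) + s \<cdot>\<^sub>v w) =
      ?f (u + b) + s * ?d (u + b) w + s\<^sup>2 * ?d w (u + b) + s ^ 3 * ?f w"
    using u w b by (intro cubic_on_line[OF F]) auto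
  also have "?f ((u + (-1) \<cdot>\<^sub>v b) + s \<cdot>\<^sub>v w) = ?f (u + (-1) \<cdot>\<^sub>v b) + s * ?d (u + (-1) \<cdot>\<^sub>v b) w
      + s\<^sup>2 * ?d w (u + (-1) \<cdot>\<^sub>v b) + s ^ 3 * ?f w"
    using u w b by (intro cubic_on_line[OF F]) auto
  also have "(?f (u + b) + s * ?d (u + b) w + s\<^sup>2 * ?d w (u + b) + s ^ 3 * ?f w
      - (?f (u + (-1) \<cdot>\<^sub>v b) + s * ?d (u + (-1) \<cdot>\<^sub>v b) w
      + s\<^sup>2 * ?d w (u + (-1) \<cdot>\<^sub>v b) + s ^ 3 * ?f w)) / 2 - ?f b
     = ((?f (u + b) - ?f (u + (-1) \<cdot>\<^sub>v b)) / 2 - ?f b)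
      + s * ((?d (u + b) w - ?d (u + (-1) \<cdot>\<^sub>v b) w) / 2)
      + s\<^sup>2 * ((?d w (u + b) - ?d w (u + (-1) \<cdot>\<^sub>v b)) / 2)"
    by (simp add: field_simps)
  finally show ?thesis by (simp add: diff[OF u] sq)
qed

text \<open>
  Euler's identity: compare the expansion of \<open>F (v + v)\<close> with \<open>F (2 v) = 8 F v\<close>.
\<close>

lemma euler_identity:
  assumes F: "homogeneous_form n 3 F" and v: "v \<in> carrier_vec n"
  shows "directional_deriv n F v v = 3 * eval_cpoly F v"
proof -
  have "v + 1 \<cdot>\<^sub>v v = (2::complex) \<cdot>\<^sub>v v" using v by (intro eq_vecI) auto
  then show ?thesis
    using cubic_on_line[OF F v v, of 1] cubic_smult[OF F v, of 2] by simp
qed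

lemma smooth_point_directional_deriv:
  assumes "smooth_form n F" "v \<in> carrier_vec n" "v \<noteq> 0\<^sub>v n" "eval_cpoly F v = 0"
  obtains w where "w \<in> carrier_vec n" "directional_deriv n F v w \<noteq> 0"
proof -
  obtain i where i: "i < n" "eval_cpoly (partial_deriv i F) v \<noteq> 0"
    using assms by (auto simp: smooth_form_def)
  have "directional_deriv n F v (unit_vec n i) =
      (\<Sum>j<n. if j = i then eval_cpoly (partial_deriv i F) v else 0)"
    unfolding directional_deriv_def by (rule sum.cong) (use i(1) in auto)
  then have "directional_deriv n F v (unit_vec n i) \<noteq> 0" using i by simp
  then show ?thesis using that by (metis unit_vec_carrier)
qed

text \<open>
  If \<open>F\<close> vanished everywhere, then so would its derivatives, and every point would be singular.
\<close>

lemma smooth_cubic_nonvanishing: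
  assumes F: "homogeneous_form n 3 F" and sm: "smooth_form n F" and n: "0 < n"
  obtains b where "b \<in> carrier_vec n" "eval_cpoly F b \<noteq> 0"
proof (rule ccontr)
  note obt = that
  assume "\<not> thesis"
  then have zero: "eval_cpoly F v = 0" if "v \<in> carrier_vec n" for v using obt[OF that] \<open>\<not> thesis\<close> by satx
  have "unit_vec n 0 \<noteq> (0\<^sub>v n :: complex vec)"
    using n by (metis index_unit_vec(1) index_zero_vec(1) zero_neq_one)
  then obtain w where w: "w \<in> carrier_vec n" "directional_deriv n F (unit_vec n 0) w \<noteq> 0"
    using smooth_point_directional_deriv[OF sm unit_vec_carrier _ zero] unit_vec_carrier by blast
  have line: "eval_cpoly F (unit_vec n 0 + s \<cdot>\<^sub>v w) = 0" for s
    using w by (intro zero) auto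
  show False
    using line[of 1] line[of "-1"] cubic_on_line[OF F unit_vec_carrier[of n 0] w(1), of 1]
      cubic_on_line[OF F unit_vec_carrier[of n 0] w(1), of "-1"] w zero[OF w(1)]
      zero[OF unit_vec_carrier[of n 0]]
    by (simp add: add_eq_0_iff)
qed

text \<open>
  A linear form in at least three variables has two independent zeros; the last two claims say that
  no point of the line in direction \<open>w\<close> through \<open>u\<close>, including the one at infinity, is the origin.
\<close>

lemma kernel_two_independent:
  fixes l :: "nat \<Rightarrow> complex"
  assumes "3 \<le> n" "k < n" "l k \<noteq> 0"
  obtains u w where "u \<in> carrier_vec n" "w \<in> carrier_vec n"
    "(\<Sum>p<n. u $ p * l p) = 0" "(\<Sum>p<n. w $ p * l p) = 0"
    "w \<noteq> 0\<^sub>v n" "\<And>s. u + s \<cdot>\<^sub>v w \<noteq> 0\<^sub>v n"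
proof -
  define e where "e i = vec n (\<lambda>p. (if p = i then l k else 0) - (if p = k then l i else 0))" for i
  define i where "i = (if k = 0 then 1 else (0::nat))"
  define j where "j = (if k = 2 then 1 else (2::nat))"
  have ij: "i < n" "j < n" "i \<noteq> j" "i \<noteq> k" "j \<noteq> k"
    using assms(1) by (auto simp: i_def j_def)
  have ker: "(\<Sum>p<n. e i $ p * l p) = 0" if "i < n" for i
  proof -
    have "(\<Sum>p<n. e i $ p * l p) =
        (\<Sum>p<n. (if p = i then l k * l i else 0) - (if p = k then l i * l k else 0))"
      by (rule sum.cong) (auto simp: e_def left_diff_distrib)
    then show ?thesis using that assms(2) by (simp add: sum_subtractf)
  qed
  have "e j $ j \<noteq> 0" "(e i + s \<cdot>\<^sub>v e j) $ i \<noteq> 0" for s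
    using ij assms(3) by (auto simp: e_def)
  then have "e j \<noteq> 0\<^sub>v n" "e i + s \<cdot>\<^sub>v e j \<noteq> 0\<^sub>v n" for s
    using ij by (metis index_zero_vec(1))+
  then show ?thesis
    using that[of "e i" "e j"] ker ij by (auto simp: e_def)
qed

text \<open>
  On the hyperplane of all \<open>a\<close> such that the derivative of \<open>F\<close> at \<open>b\<close> in direction \<open>a\<close> vanishes,
  \<open>F (a + t b)\<close> is the depressed cubic \<open>F b t\<^sup>3 + B a t + F a\<close>, with a quadratic form \<open>B\<close>. Suppose that
  its discriminant is zero on the whole hyperplane, so that \<open>4 B\<^sup>3 + 27 F b F\<^sup>2 = 0\<close> there. The
  quadratic form \<open>B\<close> has a nontrivial zero \<open>a\<close> in the hyperplane, and then \<open>F a = 0\<close>. Along any line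
  through \<open>a\<close> in the hyperplane, \<open>B\<^sup>3\<close> vanishes to order 3, hence so does \<open>F\<^sup>2\<close>, hence \<open>F\<close> vanishes
  to order 2. In direction \<open>b\<close> the derivative of \<open>F\<close> at \<open>a\<close> is \<open>B a = 0\<close>. So \<open>a\<close> is a singular point.
\<close>

lemma smooth_cubic_nondegenerate_line:
  assumes F: "homogeneous_form n 3 F" and sm: "smooth_form n F" and n: "3 \<le> n"
    and b: "b \<in> carrier_vec n" and fb: "eval_cpoly F b \<noteq> 0"
  obtains a where "a \<in> carrier_vec n" "directional_deriv n F b a = 0"
    "4 * directional_deriv n F a b ^ 3 + 27 * eval_cpoly F b * (eval_cpoly F a)\<^sup>2 \<noteq> 0"
proof (rule ccontr)
  note obt = that
  let ?f = "eval_cpoly F" and ?d = "directional_deriv n F"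
  assume "\<not> thesis"
  then have disc: "4 * ?d a b ^ 3 + 27 * ?f b * (?f a)\<^sup>2 = 0"
    if "a \<in> carrier_vec n" "?d b a = 0" for a
    using obt[OF that] \<open>\<not> thesis\<close> by satx
  have "?d b b \<noteq> 0" using euler_identity[OF F b] fb by simp
  then obtain k where "k < n" "eval_cpoly (partial_deriv k F) b \<noteq> 0"
    unfolding directional_deriv_def
    by (metis (no_types, lifting) lessThan_iff mult_zero_right sum.neutral)
  then obtain u w where uw: "u \<in> carrier_vec n" "w \<in> carrier_vec n" "?d b u = 0" "?d b w = 0"
    "w \<noteq> 0\<^sub>v n" "\<And>s. u + s \<cdot>\<^sub>v w \<noteq> 0\<^sub>v n"
    unfolding directional_deriv_def by (rule kernel_two_independent[OF n]) blast
  have lin: "?d b (u + s \<cdot>\<^sub>v w) = 0" for s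
    using uw by (simp add: directional_deriv_add directional_deriv_smult)
  \<comment> \<open>A zero of the quadratic form on the line through \<open>u\<close> and \<open>w\<close>, possibly at infinity.\<close>
  obtain a where a: "a \<in> carrier_vec n" "?d b a = 0" "a \<noteq> 0\<^sub>v n" "?d a b = 0"
  proof (cases "?d w b = 0")
    case True
    then show ?thesis using that uw by blast
  next
    case False
    let ?p = "[:?d u b, (?d (u + b) w - ?d (u + (-1) \<cdot>\<^sub>v b) w) / 2, ?d w b:]"
    have "\<exists>s. poly ?p s = 0"
      by (rule fundamental_theorem_of_algebra) (use False in \<open>simp add: constant_degree\<close>)
    then obtain s where s: "poly ?p s = 0" by blast
    have "?d (u + s \<cdot>\<^sub>v w) b = poly ?p s"
      unfolding directional_deriv_on_line[OF F uw(1,2) b]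
      by (simp add: algebra_simps power2_eq_square)
    then show ?thesis using that[of "u + s \<cdot>\<^sub>v w"] uw lin s by auto
  qed
  have fa: "?f a = 0" using disc[OF a(1,2)] a(4) fb by simp
  have tangent: "?d a w = 0" if w: "w \<in> carrier_vec n" "?d b w = 0" for w
  proof -
    define E where "E = (?d (a + b) w - ?d (a + (-1) \<cdot>\<^sub>v b) w) / 2"
    \<comment> \<open>The discriminant along the line, divided by \<open>s\<^sup>2\<close>; its value at 0 isolates the square of the
    derivative of \<open>F\<close>.\<close>
    let ?p = "[:0, 4:] * [:E, ?d w b:] ^ 3
        + smult (27 * ?f b) ([:?d a w, ?d w a, ?f w:]\<^sup>2)"
    have "poly ?p s = 0" if "poly [:0, 1:] s \<noteq> 0" for s
    proof -
      have s: "s \<noteq> 0" using that by auto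
      have "?d b (a + s \<cdot>\<^sub>v w) = 0"
        using a w by (simp add: directional_deriv_add directional_deriv_smult)
      then have "4 * ?d (a + s \<cdot>\<^sub>v w) b ^ 3 + 27 * ?f b * (?f (a + s \<cdot>\<^sub>v w))\<^sup>2 = 0"
        using a w by (intro disc) auto
      then have "4 * (s * E + s\<^sup>2 * ?d w b) ^ 3
          + 27 * ?f b * (s * ?d a w + s\<^sup>2 * ?d w a + s ^ 3 * ?f w)\<^sup>2 = 0"
        unfolding directional_deriv_on_line[OF F a(1) w(1) b] cubic_on_line[OF F a(1) w(1)] a(4) fa
        by (simp add: E_def)
      moreover have "4 * (s * E + s\<^sup>2 * ?d w b) ^ 3
          + 27 * ?f b * (s * ?d a w + s\<^sup>2 * ?d w a + s ^ 3 * ?f w)\<^sup>2 = s\<^sup>2 * poly ?p s"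
        by (simp add: poly_power algebra_simps power2_eq_square power3_eq_cube)
      ultimately show ?thesis using s by simp
    qed
    then have "poly ?p 0 = 0" by (rule poly_zero_if_zero_off_roots[where q = "[:0, 1:]", rotated]) auto
    then show ?thesis using fb by (simp add: poly_power)
  qed
  obtain w where w: "w \<in> carrier_vec n" "?d a w \<noteq> 0"
    using smooth_point_directional_deriv[OF sm a(1,3) fa] by blast
  define c where "c = ?d b w / ?d b b"
  have "?d b (w + (- c) \<cdot>\<^sub>v b) = 0"
    using w b \<open>?d b b \<noteq> 0\<close> by (simp add: directional_deriv_add directional_deriv_smult c_def)
  then have "?d a (w + (- c) \<cdot>\<^sub>v b) = 0" using w b by (intro tangent) auto
  then show False using w b a(4) by (simp add: directional_deriv_add directional_deriv_smult)
qed

text \<open>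
  Containment of zero sets forces proportionality of the forms \<open>F\<close> and \<open>F \<circ> A\<close>; the factor is read
  off at a point \<open>b\<close> where \<open>F\<close> does not vanish.
\<close>

lemma smooth_cubic_semi_invariant:
  assumes F: "homogeneous_form n 3 F" and sm: "smooth_form n F" and n: "3 \<le> n"
    and A: "A \<in> carrier_mat n n"
    and inv: "\<And>v. v \<in> carrier_vec n \<Longrightarrow> eval_cpoly F v = 0 \<Longrightarrow> eval_cpoly F (A *\<^sub>v v) = 0"
  obtains c where "\<And>v. v \<in> carrier_vec n \<Longrightarrow> eval_cpoly F (A *\<^sub>v v) = c * eval_cpoly F v"
proof -
  let ?f = "eval_cpoly F" and ?d = "directional_deriv n F"
  obtain b where b: "b \<in> carrier_vec n" and fb: "?f b \<noteq> 0"
    using smooth_cubic_nonvanishing[OF F sm] n by auto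
  obtain a where a: "a \<in> carrier_vec n" "?d b a = 0"
    "4 * ?d a b ^ 3 + 27 * ?f b * (?f a)\<^sup>2 \<noteq> 0"
    using smooth_cubic_nondegenerate_line[OF F sm n b fb] .
  have Ac: "A *\<^sub>v v \<in> carrier_vec n" if "v \<in> carrier_vec n" for v
    using A that by auto
  have Alin: "A *\<^sub>v (v + s \<cdot>\<^sub>v w) = A *\<^sub>v v + s \<cdot>\<^sub>v (A *\<^sub>v w)"
    if "v \<in> carrier_vec n" "w \<in> carrier_vec n" for v w s
    using that A by (simp add: mult_add_distrib_mat_vec mult_mat_vec)
  \<comment> \<open>On a line in direction \<open>b\<close> with three distinct roots, the combination in which the terms
  of degree 3 cancel has degree at most 2 and vanishes at these roots.\<close>
  have generic: "?f b * ?f (A *\<^sub>v (x + t \<cdot>\<^sub>v b)) = ?f (A *\<^sub>v b) * ?f (x + t \<cdot>\<^sub>v b)"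
    if x: "x \<in> carrier_vec n" "?d b x = 0" "4 * ?d x b ^ 3 + 27 * ?f b * (?f x)\<^sup>2 \<noteq> 0" for x t
  proof -
    obtain t1 t2 t3 where ts: "t1 \<noteq> t2" "t1 \<noteq> t3" "t2 \<noteq> t3"
      "\<And>t. t \<in> {t1, t2, t3} \<Longrightarrow> ?f x + t * ?d x b + t ^ 3 * ?f b = 0"
      using depressed_cubic_distinct_roots[OF fb x(3)] by metis
    let ?p = "[:?f b * ?f (A *\<^sub>v x) - ?f (A *\<^sub>v b) * ?f x,
       ?f b * ?d (A *\<^sub>v x) (A *\<^sub>v b) - ?f (A *\<^sub>v b) * ?d x b, ?f b * ?d (A *\<^sub>v b) (A *\<^sub>v x):]"
    have f: "?f (x + t \<cdot>\<^sub>v b) = ?f x + t * ?d x b + t ^ 3 * ?f b" for t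
      using cubic_on_line[OF F x(1) b] x(2) by simp
    have fA: "?f (A *\<^sub>v (x + t \<cdot>\<^sub>v b)) = ?f (A *\<^sub>v x) + t * ?d (A *\<^sub>v x) (A *\<^sub>v b)
        + t\<^sup>2 * ?d (A *\<^sub>v b) (A *\<^sub>v x) + t ^ 3 * ?f (A *\<^sub>v b)" for t
      unfolding Alin[OF x(1) b] by (rule cubic_on_line[OF F Ac[OF x(1)] Ac[OF b]])
    have p: "poly ?p t = ?f b * ?f (A *\<^sub>v (x + t \<cdot>\<^sub>v b)) - ?f (A *\<^sub>v b) * ?f (x + t \<cdot>\<^sub>v b)" for t
      unfolding f fA by (simp add: algebra_simps power2_eq_square power3_eq_cube)
    have "poly ?p t = 0" if "t \<in> {t1, t2, t3}" for t
    proof -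
      have "?f (x + t \<cdot>\<^sub>v b) = 0" using ts(4)[OF that] f by simp
      then show ?thesis unfolding p using inv[of "x + t \<cdot>\<^sub>v b"] x(1) b by simp
    qed
    then have "?p = 0" by (rule quadratic_three_roots[OF ts(1-3)])
    then have "poly ?p t = 0" by (simp only: poly_0)
    then show ?thesis unfolding p by simp
  qed
  have "?f b * ?f (A *\<^sub>v v) = ?f (A *\<^sub>v b) * ?f v" if v: "v \<in> carrier_vec n" for v
  proof -
    have "?d b b \<noteq> 0" using euler_identity[OF F b] fb by simp
    define t where "t = ?d b v / ?d b b"
    \<comment> \<open>Join the good point \<open>a\<close> to the projection of \<open>v\<close> along \<open>b\<close> to the hyperplane. The points
    \<open>y + s w\<close> lead from \<open>a + t b\<close> to \<open>v\<close>, and for almost all \<open>s\<close> they lie on good lines.\<close>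
    define w where "w = v + (- t) \<cdot>\<^sub>v b + (-1) \<cdot>\<^sub>v a"
    have w: "w \<in> carrier_vec n" "?d b w = 0"
      using v a b \<open>?d b b \<noteq> 0\<close>
      by (simp_all add: w_def t_def directional_deriv_add directional_deriv_smult)
    define E where "E = (?d (a + b) w - ?d (a + (-1) \<cdot>\<^sub>v b) w) / 2"
    define y where "y = a + t \<cdot>\<^sub>v b"
    have y: "y \<in> carrier_vec n" using a b by (simp add: y_def)
    let ?q = "smult 4 ([:?d a b, E, ?d w b:] ^ 3)
        + smult (27 * ?f b) ([:?f a, ?d a w, ?d w a, ?f w:]\<^sup>2)"
    let ?p = "smult (?f b) [:?f (A *\<^sub>v y), ?d (A *\<^sub>v y) (A *\<^sub>v w), ?d (A *\<^sub>v w) (A *\<^sub>v y), ?f (A *\<^sub>v w):]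
        - smult (?f (A *\<^sub>v b)) [:?f y, ?d y w, ?d w y, ?f w:]"
    have p: "poly ?p s = ?f b * ?f (A *\<^sub>v (y + s \<cdot>\<^sub>v w)) - ?f (A *\<^sub>v b) * ?f (y + s \<cdot>\<^sub>v w)" for s
      unfolding Alin[OF y w(1)] cubic_on_line[OF F y w(1)] cubic_on_line[OF F Ac[OF y] Ac[OF w(1)]]
      by (simp add: algebra_simps power2_eq_square power3_eq_cube)
    have q: "poly ?q s = 4 * ?d (a + s \<cdot>\<^sub>v w) b ^ 3 + 27 * ?f b * (?f (a + s \<cdot>\<^sub>v w))\<^sup>2" for s
    proof -
      have "poly [:?d a b, E, ?d w b:] s = ?d (a + s \<cdot>\<^sub>v w) b"
        unfolding directional_deriv_on_line[OF F a(1) w(1) b]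
        by (simp add: E_def algebra_simps power2_eq_square)
      moreover have "poly [:?f a, ?d a w, ?d w a, ?f w:] s = ?f (a + s \<cdot>\<^sub>v w)"
        unfolding cubic_on_line[OF F a(1) w(1)]
        by (simp add: algebra_simps power2_eq_square power3_eq_cube)
      ultimately show ?thesis by (simp only: poly_add poly_smult poly_power mult.assoc)
    qed
    have "a + 0 \<cdot>\<^sub>v w = a" using a w by (intro eq_vecI) auto
    then have "poly ?q 0 \<noteq> 0" unfolding q using a(3) by simp
    then have nz: "?q \<noteq> 0" by (metis poly_0)
    have "poly ?p s = 0" if "poly ?q s \<noteq> 0" for s
    proof -
      have ys: "y + s \<cdot>\<^sub>v w = (a + s \<cdot>\<^sub>v w) + t \<cdot>\<^sub>v b"
        using a b w unfolding y_def by (intro eq_vecI) auto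
      have "?f b * ?f (A *\<^sub>v ((a + s \<cdot>\<^sub>v w) + t \<cdot>\<^sub>v b)) = ?f (A *\<^sub>v b) * ?f ((a + s \<cdot>\<^sub>v w) + t \<cdot>\<^sub>v b)"
        by (rule generic) (use a w that q in \<open>auto simp: directional_deriv_add directional_deriv_smult\<close>)
      then show ?thesis unfolding p ys by simp
    qed
    then have "poly ?p 1 = 0" by (rule poly_zero_if_zero_off_roots[OF nz])
    moreover have "y + 1 \<cdot>\<^sub>v w = v"
      using a b v unfolding y_def w_def by (intro eq_vecI) auto
    ultimately show ?thesis unfolding p by simp
  qed
  then have "?f (A *\<^sub>v v) = (?f (A *\<^sub>v b) / ?f b) * ?f v" if "v \<in> carrier_vec n" for v
    using that fb by (simp add: field_simps)
  then show ?thesis using that by blast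
qed

section \<open>Matrices representing projective transformations\<close>

lemma smult_smult_assoc_mat: "c \<cdot>\<^sub>m (d \<cdot>\<^sub>m A) = (c * d) \<cdot>\<^sub>m (A :: complex mat)"
  by (intro eq_matI) (simp_all add: mult.assoc)

lemma one_smult_mat: "1 \<cdot>\<^sub>m A = (A :: complex mat)"
  by (intro eq_matI) simp_all

lemma GL_mult [simp]: "A \<otimes>\<^bsub>GL n\<^esub> B = A * B"
  and GL_one [simp]: "\<one>\<^bsub>GL n\<^esub> = 1\<^sub>m n"
  by (simp_all add: GL_def units_of_def ring_mat_simps)

lemma GL_carrier_iff:
  "A \<in> carrier (GL n) \<longleftrightarrow> A \<in> carrier_mat n n \<and>
     (\<exists>B\<in>carrier_mat n n. B * A = 1\<^sub>m n \<and> A * B = 1\<^sub>m n)"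
  by (simp add: GL_def units_of_carrier Units_def ring_mat_simps)

lemma GL_carrierD: "A \<in> carrier (GL n) \<Longrightarrow> A \<in> carrier_mat n n"
  by (simp add: GL_carrier_iff)

lemma GL_group: "group (GL n)"
proof -
  interpret R: semiring "ring_mat TYPE(complex) n ()" by (rule semiring_mat)
  show ?thesis unfolding GL_def by (rule R.units_group)
qed

lemma GL_inverse:
  assumes "A \<in> carrier (GL n)"
  obtains B where "B \<in> carrier (GL n)" "A * B = 1\<^sub>m n" "B * A = 1\<^sub>m n"
  using assms by (auto simp: GL_carrier_iff)

lemma GL_closed: "A \<in> carrier (GL n) \<Longrightarrow> B \<in> carrier (GL n) \<Longrightarrow> A * B \<in> carrier (GL n)"
  using monoid.m_closed[OF group.is_monoid[OF GL_group], of A n B] by simp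

lemma GL_smult: "A \<in> carrier (GL n) \<Longrightarrow> c \<noteq> 0 \<Longrightarrow> c \<cdot>\<^sub>m A \<in> carrier (GL n)"
proof -
  assume "A \<in> carrier (GL n)" and c: "c \<noteq> 0"
  then obtain B where "A \<in> carrier_mat n n" "B \<in> carrier_mat n n" "B * A = 1\<^sub>m n" "A * B = 1\<^sub>m n"
    by (auto simp: GL_carrier_iff)
  with c show "c \<cdot>\<^sub>m A \<in> carrier (GL n)"
    unfolding GL_carrier_iff
    by (intro conjI bexI[of _ "(1/c) \<cdot>\<^sub>m B"]) (auto simp: mult_smult_assoc_mat[of _ n n] mult_smult_distrib[of _ n n] smult_smult_assoc_mat)
qed

lemma scalar_mult_left: "A \<in> carrier_mat n n \<Longrightarrow> (c \<cdot>\<^sub>m 1\<^sub>m n) * A = c \<cdot>\<^sub>m (A :: complex mat)"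
  by (subst mult_smult_assoc_mat[of _ n n]) auto

lemma scalar_mult_right: "A \<in> carrier_mat n n \<Longrightarrow> A * (c \<cdot>\<^sub>m 1\<^sub>m n) = c \<cdot>\<^sub>m (A :: complex mat)"
  by (subst mult_smult_distrib[of _ n n]) auto

lemma pgl_class_eq: "A \<in> carrier_mat n n \<Longrightarrow> pgl_class n A = {c \<cdot>\<^sub>m A | c. c \<noteq> 0}"
  by (auto simp: pgl_class_def r_coset_def scalars_def scalar_mult_left
      intro!: exI[of _ "_ \<cdot>\<^sub>m 1\<^sub>m n"] simp flip: scalar_mult_left)

lemma scalars_normal: "scalars n \<lhd> GL n"
proof -
  interpret group "GL n" by (rule GL_group)
  have one: "1\<^sub>m n \<in> carrier (GL n)" using one_closed by simp
  have sub: "subgroup (scalars n) (GL n)"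
  proof (rule subgroupI)
    show "scalars n \<subseteq> carrier (GL n)" using GL_smult[OF one] by (auto simp: scalars_def)
    show "scalars n \<noteq> {}" by (auto simp: scalars_def intro: exI[of _ 1])
  next
    fix a assume "a \<in> scalars n"
    then obtain c where c: "c \<noteq> 0" "a = c \<cdot>\<^sub>m 1\<^sub>m n" by (auto simp: scalars_def)
    have "((1/c) \<cdot>\<^sub>m 1\<^sub>m n) * a = 1\<^sub>m n"
      using c by (auto simp: scalar_mult_left smult_smult_assoc_mat intro!: eq_matI)
    then have "inv\<^bsub>GL n\<^esub> a = (1/c) \<cdot>\<^sub>m 1\<^sub>m n"
      using c GL_smult[OF one] by (intro inv_equality) auto
    then show "inv\<^bsub>GL n\<^esub> a \<in> scalars n" using c by (auto simp: scalars_def)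
  next
    fix a b assume "a \<in> scalars n" "b \<in> scalars n"
    then obtain c d where c: "c \<noteq> 0" "a = c \<cdot>\<^sub>m 1\<^sub>m n" "d \<noteq> 0" "b = d \<cdot>\<^sub>m 1\<^sub>m n"
      by (auto simp: scalars_def)
    then have "a \<otimes>\<^bsub>GL n\<^esub> b = (c * d) \<cdot>\<^sub>m 1\<^sub>m n" by (simp add: scalar_mult_left smult_smult_assoc_mat)
    then show "a \<otimes>\<^bsub>GL n\<^esub> b \<in> scalars n" using c by (auto simp: scalars_def)
  qed
  show ?thesis
    unfolding normal_inv_iff
  proof (intro conjI sub ballI)
    fix x h assume x: "x \<in> carrier (GL n)" and "h \<in> scalars n"
    then obtain c where c: "c \<noteq> 0" "h = c \<cdot>\<^sub>m 1\<^sub>m n" by (auto simp: scalars_def)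
    have "x \<otimes>\<^bsub>GL n\<^esub> h = h \<otimes>\<^bsub>GL n\<^esub> x"
      using x c by (simp add: scalar_mult_left scalar_mult_right GL_carrierD)
    then have "x \<otimes>\<^bsub>GL n\<^esub> h \<otimes>\<^bsub>GL n\<^esub> inv\<^bsub>GL n\<^esub> x = h"
      using x \<open>h \<in> scalars n\<close> subgroup.mem_carrier[OF sub]
      by (simp add: m_assoc del: GL_mult GL_one)
    then show "x \<otimes>\<^bsub>GL n\<^esub> h \<otimes>\<^bsub>GL n\<^esub> inv\<^bsub>GL n\<^esub> x \<in> scalars n"
      using \<open>h \<in> scalars n\<close> by simp
  qed
qed

lemma PGL_group: "group (PGL n)"
  unfolding PGL_def by (rule normal.factorgroup_is_group[OF scalars_normal])

lemma PGL_carrier: "carrier (PGL n) = pgl_class n ` carrier (GL n)"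
  by (simp add: PGL_def carrier_FactGroup pgl_class_def)

lemma pgl_class_mult:
  "A \<in> carrier (GL n) \<Longrightarrow> B \<in> carrier (GL n) \<Longrightarrow>
     pgl_class n A \<otimes>\<^bsub>PGL n\<^esub> pgl_class n B = pgl_class n (A * B)"
  unfolding pgl_class_def PGL_def
  using hom_mult[OF normal.r_coset_hom_Mod[OF scalars_normal]] by simp

lemma pgl_class_one: "pgl_class n (1\<^sub>m n) = \<one>\<^bsub>PGL n\<^esub>"
  by (simp add: pgl_class_eq PGL_def scalars_def)

lemma pgl_class_smult:
  assumes "A \<in> carrier_mat n n" "c \<noteq> 0"
  shows "pgl_class n (c \<cdot>\<^sub>m A) = pgl_class n A"
proof -
  have "\<exists>d. k \<cdot>\<^sub>m A = d \<cdot>\<^sub>m (c \<cdot>\<^sub>m A) \<and> d \<noteq> 0" if "k \<noteq> 0" for k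
    by (rule exI[of _ "k / c"]) (use that assms in \<open>simp add: smult_smult_assoc_mat\<close>)
  then show ?thesis
    using assms by (auto simp: pgl_class_eq smult_smult_assoc_mat)
qed

lemma pgl_class_eqD:
  assumes "pgl_class n A = pgl_class n B" "A \<in> carrier_mat n n" "B \<in> carrier_mat n n"
  obtains c where "c \<noteq> 0" "A = c \<cdot>\<^sub>m B"
proof -
  have "A \<in> pgl_class n A"
    using assms(2) by (auto simp: pgl_class_eq intro!: exI[of _ 1])
  then show ?thesis using that assms by (auto simp: pgl_class_eq)
qed

section \<open>The Pauli group and its subgroups of type (3, 6)\<close>

definition unity_root :: "nat \<Rightarrow> complex" where
  "unity_root n = cis (2 * pi / real n)"

lemma unity_root_exp: "exp (2 * of_real pi * \<i> / of_nat n) = unity_root n"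
  by (simp add: unity_root_def cis_conv_exp mult_ac)

lemma unity_root_nonzero [simp]: "unity_root n \<noteq> 0"
  by (simp add: unity_root_def)

lemma unity_root_power: "unity_root n ^ k = cis (2 * pi * real k / real n)"
  by (simp add: unity_root_def DeMoivre mult_ac)

lemma unity_root_power_mod: "0 < n \<Longrightarrow> unity_root n ^ (k mod n) = unity_root n ^ k"
proof -
  assume "0 < n"
  then have "unity_root n ^ n = 1" by (simp add: unity_root_power)
  then have "unity_root n ^ (n * (k div n) + k mod n) = unity_root n ^ (k mod n)"
    unfolding power_add power_mult by simp
  then show ?thesis unfolding mult_div_mod_eq by simp
qed

lemma unity_root_power_eq_iff:
  assumes "0 < n"
  shows "unity_root n ^ k = unity_root n ^ l \<longleftrightarrow> k mod n = l mod n"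
proof
  assume "unity_root n ^ k = unity_root n ^ l"
  then have "unity_root n ^ (k mod n) = unity_root n ^ (l mod n)"
    using assms by (simp add: unity_root_power_mod)
  moreover have "inj_on (\<lambda>k. cis (2 * pi * real k / real n)) {..<n}"
    using bij_betw_roots_unity[OF assms] by (auto simp: bij_betw_def)
  ultimately show "k mod n = l mod n"
    using assms unfolding unity_root_power by (auto dest: inj_onD)
qed (metis assms unity_root_power_mod)

lemma unity_root_mult: "0 < m \<Longrightarrow> unity_root (m * n) ^ m = unity_root n"
  by (simp add: unity_root_def DeMoivre)

text \<open>
  This is \<open>P\<^sup>a W\<^sup>b\<close>. Exponents are natural numbers, taken modulo \<open>n\<close> only where needed, so that
  products of classes are given by adding exponents.
\<close>

definition weyl_mat :: "nat \<Rightarrow> nat \<Rightarrow> nat \<Rightarrow> complex mat" where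
  "weyl_mat n a b = mat n n (\<lambda>(i, j). if j = (i + a) mod n then unity_root n ^ (b * j) else 0)"

lemma weyl_mat_carrier [simp]: "weyl_mat n a b \<in> carrier_mat n n"
  by (simp add: weyl_mat_def)

text \<open>
  The Weyl commutation relation \<open>W\<^sup>b P\<^sup>c = \<omega>\<^sup>-\<^sup>b\<^sup>c P\<^sup>c W\<^sup>b\<close>, with the scalar on the side where its
  exponent is not negative.
\<close>

lemma weyl_mat_mult:
  assumes n: "0 < n"
  shows "unity_root n ^ (b * c) \<cdot>\<^sub>m (weyl_mat n a b * weyl_mat n c d) = weyl_mat n (a + c) (b + d)"
proof (rule eq_matI)
  fix i j assume "i < dim_row (weyl_mat n (a + c) (b + d))" "j < dim_col (weyl_mat n (a + c) (b + d))"
  then have ij: "i < n" "j < n" by (simp_all add: weyl_mat_def)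
  let ?w = "unity_root n" and ?k = "(i + a) mod n"
  have "(weyl_mat n a b * weyl_mat n c d) $$ (i, j) =
     (\<Sum>k = 0..<n. (if k = ?k then ?w ^ (b * k) else 0) * (if j = (k + c) mod n then ?w ^ (d * j) else 0))"
    using ij by (simp add: weyl_mat_def scalar_prod_def)
  also have "\<dots> = (\<Sum>k = 0..<n. if k = ?k then ?w ^ (b * ?k) * (if j = (?k + c) mod n then ?w ^ (d * j) else 0) else 0)"
    by (rule sum.cong) auto
  also have "\<dots> = ?w ^ (b * ?k) * (if j = (i + (a + c)) mod n then ?w ^ (d * j) else 0)"
    using n by (simp add: mod_add_left_eq add.assoc)
  finally have entry: "(weyl_mat n a b * weyl_mat n c d) $$ (i, j) =
     ?w ^ (b * ?k) * (if j = (i + (a + c)) mod n then ?w ^ (d * j) else 0)" .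
  have "?w ^ (b * c) * (?w ^ (b * ?k) * ?w ^ (d * j)) = ?w ^ ((b + d) * j)"
    if "j = (i + (a + c)) mod n"
  proof -
    have "j = (c + ?k) mod n"
      unfolding that mod_add_right_eq by (simp add: ac_simps)
    then have "(b * (c + ?k)) mod n = (b * j) mod n"
      by (simp only: mod_mult_right_eq)
    then have "?w ^ (b * (c + ?k)) = ?w ^ (b * j)"
      by (simp add: unity_root_power_eq_iff[OF n])
    then show ?thesis by (simp add: distrib_left distrib_right power_add)
  qed
  then show "(?w ^ (b * c) \<cdot>\<^sub>m (weyl_mat n a b * weyl_mat n c d)) $$ (i, j)
      = weyl_mat n (a + c) (b + d) $$ (i, j)"
    using ij entry by (simp add: weyl_mat_def)
qed (simp_all add: weyl_mat_def)

lemma weyl_mat_cong: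
  assumes "0 < n" "a mod n = c mod n" "b mod n = d mod n"
  shows "weyl_mat n a b = weyl_mat n c d"
proof -
  have "(i + a) mod n = (i + c) mod n" for i using assms(2) by (metis mod_add_right_eq)
  moreover have "unity_root n ^ (b * j) = unity_root n ^ (d * j)" for j
    unfolding unity_root_power_eq_iff[OF assms(1)] using assms(3) by (metis mod_mult_left_eq)
  ultimately show ?thesis by (intro eq_matI) (simp_all add: weyl_mat_def)
qed

lemma weyl_mat_0_0: "weyl_mat n 0 0 = 1\<^sub>m n"
  by (rule eq_matI) (auto simp: weyl_mat_def)

lemma weyl_mat_GL: 
  assumes n: "0 < n"
  shows "weyl_mat n a b \<in> carrier (GL n)"
proof -
  let ?c = "unity_root n ^ (b * ((n - 1) * a))" and ?c' = "unity_root n ^ ((n - 1) * b * a)"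
  let ?B = "weyl_mat n ((n - 1) * a) ((n - 1) * b)"
  have *: "weyl_mat n (n * a) (n * b) = 1\<^sub>m n"
    using weyl_mat_cong[OF n, of "n * a" 0 "n * b" 0] by (simp add: weyl_mat_0_0)
  have s: "k + (n - 1) * k = n * k" "(n - 1) * k + k = n * k" for k
    using n by (cases n; simp)+
  have "?c \<cdot>\<^sub>m (weyl_mat n a b * ?B) = 1\<^sub>m n" "?c' \<cdot>\<^sub>m (?B * weyl_mat n a b) = 1\<^sub>m n"
    unfolding weyl_mat_mult[OF n] s * by simp_all
  then have "weyl_mat n a b * (?c \<cdot>\<^sub>m ?B) = 1\<^sub>m n" "(?c' \<cdot>\<^sub>m ?B) * weyl_mat n a b = 1\<^sub>m n"
    by (simp_all only: mult_smult_assoc_mat[OF weyl_mat_carrier weyl_mat_carrier]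
        mult_smult_distrib[OF weyl_mat_carrier weyl_mat_carrier])
  moreover have "?c = ?c'" by (simp add: mult_ac)
  ultimately show ?thesis
    unfolding GL_carrier_iff by (intro conjI bexI[of _ "?c \<cdot>\<^sub>m ?B"]) auto
qed

abbreviation weyl_class :: "nat \<Rightarrow> nat \<Rightarrow> nat \<Rightarrow> complex mat set" where
  "weyl_class n a b \<equiv> pgl_class n (weyl_mat n a b)"

lemma weyl_class_mult:
  assumes "0 < n"
  shows "weyl_class n a b \<otimes>\<^bsub>PGL n\<^esub> weyl_class n c d = weyl_class n (a + c) (b + d)"
proof -
  have "weyl_class n a b \<otimes>\<^bsub>PGL n\<^esub> weyl_class n c d = pgl_class n (weyl_mat n a b * weyl_mat n c d)"
    by (rule pgl_class_mult[OF weyl_mat_GL[OF assms] weyl_mat_GL[OF assms]])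
  also have "\<dots> = pgl_class n (unity_root n ^ (b * c) \<cdot>\<^sub>m (weyl_mat n a b * weyl_mat n c d))"
    by (rule pgl_class_smult[symmetric]) (auto intro!: mult_carrier_mat[of _ n n])
  finally show ?thesis unfolding weyl_mat_mult[OF assms] .
qed

lemma weyl_class_carrier: "0 < n \<Longrightarrow> weyl_class n a b \<in> carrier (PGL n)"
  unfolding PGL_carrier by (intro imageI weyl_mat_GL)

lemma weyl_class_0_0: "weyl_class n 0 0 = \<one>\<^bsub>PGL n\<^esub>"
  by (simp add: weyl_mat_0_0 pgl_class_one)

lemma weyl_class_inv:
  assumes n: "0 < n"
  shows "inv\<^bsub>PGL n\<^esub> weyl_class n a b = weyl_class n ((n - 1) * a) ((n - 1) * b)"
proof -
  interpret group "PGL n" by (rule PGL_group)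
  have "(n - 1) * k + k = n * k" for k
    using n by (cases n) simp_all
  then have "weyl_class n ((n - 1) * a) ((n - 1) * b) \<otimes>\<^bsub>PGL n\<^esub> weyl_class n a b = weyl_class n 0 0"
    using weyl_mat_cong[OF n, of "n * a" 0 "n * b" 0] by (simp add: weyl_class_mult[OF n])
  then show ?thesis
    by (intro inv_equality) (simp_all add: weyl_class_0_0 weyl_class_carrier n)
qed

text \<open>
  The Pauli group is a product of two cyclic groups of order \<open>n\<close>: the position of the nonzero entries
  determines \<open>a\<close> modulo \<open>n\<close>, and the ratio of the entries in the first two columns is \<open>\<omega>\<^sup>b\<close>.
\<close>

lemma weyl_class_eq_iff:
  assumes n: "0 < n"
  shows "weyl_class n a b = weyl_class n c d \<longleftrightarrow> a mod n = c mod n \<and> b mod n = d mod n"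
proof
  let ?w = "unity_root n"
  assume "weyl_class n a b = weyl_class n c d"
  then obtain k where k: "k \<noteq> 0" "weyl_mat n a b = k \<cdot>\<^sub>m weyl_mat n c d"
    by (rule pgl_class_eqD) auto
  have entry: "(if j = (i + a) mod n then ?w ^ (b * j) else 0)
      = k * (if j = (i + c) mod n then ?w ^ (d * j) else 0)" if "i < n" "j < n" for i j
  proof -
    have "weyl_mat n a b $$ (i, j) = (k \<cdot>\<^sub>m weyl_mat n c d) $$ (i, j)" using k(2) by simp
    then show ?thesis using that by (simp add: weyl_mat_def)
  qed
  have ac: "a mod n = c mod n"
    using entry[of 0 "a mod n"] n by (auto split: if_splits)
  have col: "?w ^ (b * j) = k * ?w ^ (d * j)" if "j < n" for j
  proof -
    \<comment> \<open>The row of the nonzero entry in column \<open>j\<close>; multiplying by \<open>n - 1\<close> replaces subtraction of \<open>a\<close>.\<close>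
    let ?i = "(j + (n - 1) * a) mod n"
    have "(?i + a) mod n = (j + ((n - 1) * a + a)) mod n"
      by (simp add: mod_add_left_eq add.assoc)
    also have "(n - 1) * a + a = n * a"
      using n by (cases n) simp_all
    finally have "(?i + a) mod n = (j + n * a) mod n" .
    then have i: "(?i + a) mod n = j" using that by simp
    then have "(?i + c) mod n = j" using ac by (metis mod_add_right_eq)
    then show ?thesis using entry[of ?i j] i n that by simp
  qed
  have "?w ^ b = ?w ^ d"
  proof (cases "n = 1")
    case False
    then show ?thesis using col[of 0] col[of 1] n by simp
  qed (simp add: unity_root_power_eq_iff)
  then show "a mod n = c mod n \<and> b mod n = d mod n"
    using ac unity_root_power_eq_iff[OF n] by simp
qed (metis weyl_mat_cong[OF n])

lemma weyl_class_generate: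
  assumes n: "0 < n"
  shows "generate (PGL n) {weyl_class n a b, weyl_class n c d}
     = {weyl_class n (x * a + y * c) (x * b + y * d) | x y. True}" (is "?L = ?R")
proof
  interpret group "PGL n" by (rule PGL_group)
  have mem: "weyl_class n (x * a + y * c) (x * b + y * d) \<in> ?R" for x y by blast
  show "?L \<subseteq> ?R"
  proof
    fix z assume "z \<in> ?L"
    then show "z \<in> ?R"
    proof induction
      case one
      show ?case using mem[of 0 0] by (simp add: weyl_class_0_0)
    next
      case (incl h)
      then show ?case using mem[of 1 0] mem[of 0 1] by auto
    next
      case (inv h)
      then consider "h = weyl_class n a b" | "h = weyl_class n c d" by auto
      then show ?case
      proof cases
        case 1
        show ?thesis unfolding 1 weyl_class_inv[OF n] using mem[of "n - 1" 0] by simp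
      next
        case 2
        show ?thesis unfolding 2 weyl_class_inv[OF n] using mem[of 0 "n - 1"] by simp
      qed
    next
      case (eng h1 h2)
      then obtain x y x' y' where "h1 = weyl_class n (x * a + y * c) (x * b + y * d)"
        "h2 = weyl_class n (x' * a + y' * c) (x' * b + y' * d)" by blast
      then have "h1 \<otimes>\<^bsub>PGL n\<^esub> h2 = weyl_class n ((x + x') * a + (y + y') * c) ((x + x') * b + (y + y') * d)"
        by (simp add: weyl_class_mult[OF n] algebra_simps)
      then show ?case using mem by simp
    qed
  qed
  have pow: "weyl_class n (x * e) (x * f) \<in> ?L" if "weyl_class n e f \<in> ?L" for x e f
  proof (induction x)
    case 0
    show ?case using generate.one[of "PGL n"] by (simp add: weyl_class_0_0)
  next
    case (Suc x)
    then show ?case using generate.eng[OF that Suc] by (simp add: weyl_class_mult[OF n])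
  qed
  show "?R \<subseteq> ?L"
  proof
    fix z assume "z \<in> ?R"
    then obtain x y where z: "z = weyl_class n (x * a) (x * b) \<otimes>\<^bsub>PGL n\<^esub> weyl_class n (y * c) (y * d)"
      by (auto simp: weyl_class_mult[OF n])
    show "z \<in> ?L" unfolding z by (intro generate.eng pow generate.incl) auto
  qed
qed

lemma P_mat_eq_weyl: "P_mat n = weyl_mat n 1 0"
  by (rule eq_matI) (auto simp: P_mat_def weyl_mat_def)

lemma W_mat_power:
  assumes n: "0 < n"
  shows "W_mat n ^\<^sub>m k = weyl_mat n 0 k"
proof (induction k)
  case 0
  show ?case by (simp add: weyl_mat_0_0) (simp add: W_mat_def)
next
  case (Suc k)
  have W: "W_mat n = weyl_mat n 0 1"
    by (rule eq_matI) (auto simp: W_mat_def weyl_mat_def unity_root_exp)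
  show ?case
    using Suc weyl_mat_mult[OF n, of k 0 0 1] W by (simp add: one_smult_mat)
qed

lemma pauli_eq: "0 < n \<Longrightarrow> pauli n = {weyl_class n x y | x y. True}"
  using weyl_class_generate[of n 1 0 0 1] W_mat_power[of n 1]
  by (simp add: pauli_def P_mat_eq_weyl W_mat_def)

lemma pauli_subgroup_36_eq:
  "pauli_subgroup_36 i = {weyl_class 6 y (2 * x + i * y) | x y. True}"
  using weyl_class_generate[of 6 0 2 1 i] weyl_mat_mult[of 6 0 0 1 i]
  by (simp add: pauli_subgroup_36_def W_mat_power P_mat_eq_weyl mult_ac one_smult_mat)

text \<open>
  The isomorphism sends \<open>(x, y)\<close> to the class of \<open>W\<^sup>2\<^sup>x (P W\<^sup>i)\<^sup>y\<close>.
\<close>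

lemma pauli_subgroup_36_iso:
  "(PGL 6)\<lparr>carrier := pauli_subgroup_36 i\<rparr> \<cong> integer_mod_group 3 \<times>\<times> integer_mod_group 6"
proof -
  let ?Z = "integer_mod_group 3 \<times>\<times> integer_mod_group 6"
  let ?S = "(PGL 6)\<lparr>carrier := pauli_subgroup_36 i\<rparr>"
  define f where "f = (\<lambda>(x, y). weyl_class 6 (nat y) (2 * nat x + i * nat y))"
  have carr: "carrier ?Z = {0..<3} \<times> {0..<6}"
    by (simp add: DirProd_def carrier_integer_mod_group)
  have "f \<in> hom ?Z ?S"
  proof (rule homI)
    fix p assume "p \<in> carrier ?Z"
    then show "f p \<in> carrier ?S"
      by (auto simp: f_def pauli_subgroup_36_eq split: prod.splits)
  next
    fix p q assume "p \<in> carrier ?Z" "q \<in> carrier ?Z"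
    then obtain x y x' y' where pq: "p = (x, y)" "q = (x', y')" "0 \<le> x" "0 \<le> y" "0 \<le> x'" "0 \<le> y'"
      unfolding carr by auto
    then obtain a b a' b' where "x = int a" "y = int b" "x' = int a'" "y' = int b'"
      by (meson nonneg_int_cases)
    then have ab: "p = (int a, int b)" "q = (int a', int b')" using pq by simp_all
    have m: "nat ((int k + int l) mod int r) = (k + l) mod r" for k l r
      by (simp flip: of_nat_add zmod_int)
    have "f (p \<otimes>\<^bsub>?Z\<^esub> q) = weyl_class 6 ((b + b') mod 6) (2 * ((a + a') mod 3) + i * ((b + b') mod 6))"
      using m[of a a' 3] m[of b b' 6] by (simp add: ab f_def)
    also have "\<dots> = weyl_class 6 (b + b') ((2 * a + i * b) + (2 * a' + i * b'))"
    proof -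
      have "(2 * ((a + a') mod 3)) mod 6 = (2 * (a + a')) mod 6"
        using mult_mod_right[of 2 "a + a'" 3] by simp
      moreover have "(i * ((b + b') mod 6)) mod 6 = (i * (b + b')) mod 6"
        by (rule mod_mult_right_eq)
      ultimately have "(2 * ((a + a') mod 3) + i * ((b + b') mod 6)) mod 6
          = (2 * (a + a') + i * (b + b')) mod 6"
        by (rule mod_add_cong)
      then show ?thesis unfolding weyl_class_eq_iff[of 6, simplified] by (simp add: algebra_simps)
    qed
    also have "\<dots> = f p \<otimes>\<^bsub>?S\<^esub> f q"
      by (simp add: ab f_def weyl_class_mult[of 6, simplified])
    finally show "f (p \<otimes>\<^bsub>?Z\<^esub> q) = f p \<otimes>\<^bsub>?S\<^esub> f q" .
  qed
  moreover have "inj_on f (carrier ?Z)"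
  proof (rule inj_onI)
    fix p q assume pq: "p \<in> carrier ?Z" "q \<in> carrier ?Z" and eq: "f p = f q"
    obtain x y x' y' where p: "p = (x, y)" "q = (x', y')" by fastforce
    have b: "0 \<le> x" "x < 3" "0 \<le> x'" "x' < 3" "0 \<le> y" "y < 6" "0 \<le> y'" "y' < 6"
      using pq unfolding p carr by auto
    have "nat y mod 6 = nat y' mod 6"
      and e: "(2 * nat x + i * nat y) mod 6 = (2 * nat x' + i * nat y') mod 6"
      using eq unfolding p f_def by (simp_all add: weyl_class_eq_iff[of 6, simplified])
    then have y: "nat y = nat y'" using b by simp
    have "(2 * nat x) mod 6 = (2 * nat x') mod 6"
    proof -
      have "[2 * nat x + i * nat y' = 2 * nat x' + i * nat y'] (mod 6)"
        using e y by (simp add: cong_def)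
      then have "[2 * nat x = 2 * nat x'] (mod 6)" by (simp only: cong_add_rcancel_nat)
      then show ?thesis by (simp only: cong_def)
    qed
    then have "nat x = nat x'" using b by simp
    then show "p = q" using y b p by (simp add: eq_nat_nat_iff)
  qed
  moreover have "f ` carrier ?Z = carrier ?S"
  proof
    show "f ` carrier ?Z \<subseteq> carrier ?S"
      by (auto simp: f_def pauli_subgroup_36_eq split: prod.splits)
    show "carrier ?S \<subseteq> f ` carrier ?Z"
    proof
      fix z assume "z \<in> carrier ?S"
      then obtain x y where z: "z = weyl_class 6 y (2 * x + i * y)"
        by (auto simp: pauli_subgroup_36_eq)
      have "(2 * (x mod 3)) mod 6 = (2 * x) mod 6"
        using mult_mod_right[of 2 x 3] by simp
      moreover have "(i * (y mod 6)) mod 6 = (i * y) mod 6"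
        by (rule mod_mult_right_eq)
      ultimately have "(2 * (x mod 3) + i * (y mod 6)) mod 6 = (2 * x + i * y) mod 6"
        by (rule mod_add_cong)
      then have "z = f (int (x mod 3), int (y mod 6))"
        unfolding z f_def by (simp add: weyl_class_eq_iff[of 6, simplified] nat_mod_as_int)
      then show "z \<in> f ` carrier ?Z" unfolding carr by (intro image_eqI) auto
    qed
  qed
  ultimately have "f \<in> iso ?Z ?S" by (simp add: iso_def bij_betw_def)
  then have "?Z \<cong> ?S" by (rule is_isoI)
  then show ?thesis by (rule group.iso_sym[rotated]) (simp add: DirProd_group)
qed

section \<open>Tensor decomposition of the Pauli group in dimension six\<close>

lemma kronecker_carrier:
  "A \<in> carrier_mat n n \<Longrightarrow> B \<in> carrier_mat m m \<Longrightarrow> kronecker A B \<in> carrier_mat (n * m) (n * m)"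
  by (auto simp: kronecker_def)

lemma kronecker_index:
  assumes "A \<in> carrier_mat n n" "B \<in> carrier_mat m m" "i < n * m" "j < n * m"
  shows "kronecker A B $$ (i, j) = A $$ (i div m, j div m) * B $$ (i mod m, j mod m)"
  using assms by (auto simp: kronecker_def)

lemma kronecker_mult:
  assumes A: "A \<in> carrier_mat n n" "C \<in> carrier_mat n n"
    and B: "B \<in> carrier_mat m m" "D \<in> carrier_mat m m"
  shows "kronecker A B * kronecker C D = kronecker (A * C) (B * D)"
proof (rule eq_matI)
  have carr: "kronecker A B \<in> carrier_mat (n * m) (n * m)" "kronecker C D \<in> carrier_mat (n * m) (n * m)"
    "kronecker (A * C) (B * D) \<in> carrier_mat (n * m) (n * m)"
    using A B by (auto intro!: kronecker_carrier mult_carrier_mat[of _ n n] mult_carrier_mat[of _ m m])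
  then show "dim_row (kronecker A B * kronecker C D) = dim_row (kronecker (A * C) (B * D))"
    "dim_col (kronecker A B * kronecker C D) = dim_col (kronecker (A * C) (B * D))" by auto
  fix i j assume "i < dim_row (kronecker (A * C) (B * D))" "j < dim_col (kronecker (A * C) (B * D))"
  then have ij: "i < n * m" "j < n * m" using carr by auto
  then have m: "0 < m" by (cases m) auto
  have ij': "i div m < n" "j div m < n" "i mod m < m" "j mod m < m"
    using ij m by (simp_all add: less_mult_imp_div_less)
  define f where "f = (\<lambda>p q. A $$ (i div m, p) * B $$ (i mod m, q) * (C $$ (p, j div m) * D $$ (q, j mod m)))"
  have "(kronecker A B * kronecker C D) $$ (i, j) =
     (\<Sum>k = 0..<n * m. kronecker A B $$ (i, k) * kronecker C D $$ (k, j))"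
    using carr ij by (simp add: scalar_prod_def)
  also have "\<dots> = (\<Sum>k = 0..<n * m. f (k div m) (k mod m))"
    by (rule sum.cong) (use ij A B in \<open>auto simp: kronecker_index f_def\<close>)
  also have "\<dots> = (\<Sum>(p, q) \<in> {0..<n} \<times> {0..<m}. f p q)"
  proof (rule sum.reindex_bij_witness[where i = "\<lambda>(p, q). p * m + q" and j = "\<lambda>k. (k div m, k mod m)"])
    fix pq assume "pq \<in> {0..<n} \<times> {0..<m}"
    then obtain p q where pq: "pq = (p, q)" "p < n" "q < m" by auto
    have "p * m + q < (p + 1) * m" using pq by simp
    also have "\<dots> \<le> n * m" using pq(2) by (intro mult_le_mono1) simp
    finally show "(case pq of (p, q) \<Rightarrow> p * m + q) \<in> {0..<n * m}" using pq by simp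
    show "((case pq of (p, q) \<Rightarrow> p * m + q) div m, (case pq of (p, q) \<Rightarrow> p * m + q) mod m) = pq"
      using pq by simp
  qed (use m in \<open>auto simp: less_mult_imp_div_less\<close>)
  also have "\<dots> = (\<Sum>p = 0..<n. A $$ (i div m, p) * C $$ (p, j div m)) *
      (\<Sum>q = 0..<m. B $$ (i mod m, q) * D $$ (q, j mod m))"
    by (simp add: f_def sum_product sum.cartesian_product[symmetric] mult_ac)
  also have "\<dots> = (A * C) $$ (i div m, j div m) * (B * D) $$ (i mod m, j mod m)"
    using A B ij' by (simp add: scalar_prod_def)
  also have "\<dots> = kronecker (A * C) (B * D) $$ (i, j)"
    using A B ij by (simp add: kronecker_index[of _ n _ m] mult_carrier_mat[of _ n n] mult_carrier_mat[of _ m m])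
  finally show "(kronecker A B * kronecker C D) $$ (i, j) = kronecker (A * C) (B * D) $$ (i, j)" .
qed

lemma kronecker_one: "kronecker (1\<^sub>m n) (1\<^sub>m m) = 1\<^sub>m (n * m)"
proof (rule eq_matI)
  fix i j assume "i < dim_row (1\<^sub>m (n * m) :: complex mat)" "j < dim_col (1\<^sub>m (n * m) :: complex mat)"
  then have ij: "i < n * m" "j < n * m" by auto
  then have m: "0 < m" by (cases m) auto
  have "i div m < n" "j div m < n" "i mod m < m" "j mod m < m"
    using ij m by (simp_all add: less_mult_imp_div_less)
  moreover have "i = j \<longleftrightarrow> i div m = j div m \<and> i mod m = j mod m"
    by (metis div_mult_mod_eq)
  ultimately show "kronecker (1\<^sub>m n) (1\<^sub>m m) $$ (i, j) = (1\<^sub>m (n * m) :: complex mat) $$ (i, j)"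
    using ij by (simp add: kronecker_index[of _ n _ m])
qed (simp_all add: kronecker_def)

lemma kronecker_GL:
  assumes "A \<in> carrier (GL n)" "B \<in> carrier (GL m)"
  shows "kronecker A B \<in> carrier (GL (n * m))"
proof -
  obtain A' B' where A: "A' \<in> carrier (GL n)" "A * A' = 1\<^sub>m n" "A' * A = 1\<^sub>m n"
    and B: "B' \<in> carrier (GL m)" "B * B' = 1\<^sub>m m" "B' * B = 1\<^sub>m m"
    using GL_inverse[OF assms(1)] GL_inverse[OF assms(2)] by metis
  have c: "A \<in> carrier_mat n n" "A' \<in> carrier_mat n n" "B \<in> carrier_mat m m" "B' \<in> carrier_mat m m"
    using assms A B by (auto dest: GL_carrierD)
  show ?thesis
    unfolding GL_carrier_iff
  proof (intro conjI bexI)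
    show "kronecker A' B' * kronecker A B = 1\<^sub>m (n * m)"
      unfolding kronecker_mult[OF c(2,1) c(4,3)] A B by (rule kronecker_one)
    show "kronecker A B * kronecker A' B' = 1\<^sub>m (n * m)"
      unfolding kronecker_mult[OF c(1,2) c(3,4)] A B by (rule kronecker_one)
  qed (intro kronecker_carrier c)+
qed

text \<open>
  The permutation matrix of the Chinese remainder bijection: \<open>k\<close> corresponds to the index of
  \<open>(k mod 2, k mod 3)\<close> in the row numbering of Kronecker products.
\<close>

definition crt_mat :: "complex mat" where
  "crt_mat = mat 6 6 (\<lambda>(s, k). if s = 3 * (k mod 2) + k mod 3 then 1 else 0)"

lemma less_6_cases: "n < 6 \<Longrightarrow> n \<in> {0, 1, 2, 3, 4, 5 :: nat}"
  by (auto simp: less_Suc_eq eval_nat_numeral)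

text \<open>
  The inverse bijection, from the idempotents 3 and 4 modulo 6.
\<close>

lemma crt_index_iff:
  fixes s k :: nat
  assumes "s < 6" "k < 6"
  shows "s = 3 * (k mod 2) + k mod 3 \<longleftrightarrow> k = (3 * (s div 3) + 4 * (s mod 3)) mod 6"
  using less_6_cases[OF assms(1)] less_6_cases[OF assms(2)] by (elim insertE emptyE; simp)

lemma sum_indicator_mult:
  fixes f :: "nat \<Rightarrow> complex"
  assumes "c < n" "\<And>k. k < n \<Longrightarrow> P k \<longleftrightarrow> k = c"
  shows "(\<Sum>k = 0..<n. (if P k then 1 else 0) * f k) = f c"
    and "(\<Sum>k = 0..<n. f k * (if P k then 1 else 0)) = f c"
proof -
  have "(\<Sum>k = 0..<n. (if P k then 1 else 0) * f k) = (\<Sum>k = 0..<n. if k = c then f k else 0)"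
    "(\<Sum>k = 0..<n. f k * (if P k then 1 else 0)) = (\<Sum>k = 0..<n. if k = c then f k else 0)"
    by (rule sum.cong[OF refl], use assms(2) in simp)+
  then show "(\<Sum>k = 0..<n. (if P k then 1 else 0) * f k) = f c"
    and "(\<Sum>k = 0..<n. f k * (if P k then 1 else 0)) = f c"
    using assms(1) by simp_all
qed

lemma crt_mat_GL: "crt_mat \<in> carrier (GL 6)"
proof -
  define T where "T = mat 6 6 (\<lambda>(k, s). if s = 3 * (k mod 2) + k mod 3 then 1 else (0::complex))"
  have "crt_mat * T = 1\<^sub>m 6"
  proof (rule eq_matI)
    fix s t assume "s < dim_row (1\<^sub>m 6 :: complex mat)" "t < dim_col (1\<^sub>m 6 :: complex mat)"
    then have st: "s < 6" "t < 6" by auto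
    define c where "c = (3 * (s div 3) + 4 * (s mod 3)) mod 6"
    have c: "c < 6" by (simp add: c_def)
    have "(crt_mat * T) $$ (s, t) = (\<Sum>k = 0..<6. (if s = 3 * (k mod 2) + k mod 3 then 1 else 0) *
        (if t = 3 * (k mod 2) + k mod 3 then 1 else 0))"
      using st by (simp add: crt_mat_def T_def scalar_prod_def)
    also have "\<dots> = (if t = 3 * (c mod 2) + c mod 3 then 1 else 0)"
      by (rule sum_indicator_mult(1)[OF c]) (simp only: crt_index_iff[OF st(1)] c_def)
    also have "3 * (c mod 2) + c mod 3 = s"
      by (rule sym) (rule iffD2[OF crt_index_iff[OF st(1) c] c_def])
    finally show "(crt_mat * T) $$ (s, t) = 1\<^sub>m 6 $$ (s, t)"
      using st by (simp only: index_one_mat eq_commute)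
  qed (auto simp: crt_mat_def T_def)
  moreover have "T * crt_mat = 1\<^sub>m 6"
  proof (rule eq_matI)
    fix k l assume "k < dim_row (1\<^sub>m 6 :: complex mat)" "l < dim_col (1\<^sub>m 6 :: complex mat)"
    then have kl: "k < 6" "l < 6" by auto
    define c where "c = 3 * (k mod 2) + k mod 3"
    have c: "c < 6" using mod_less_divisor[of 2 k] mod_less_divisor[of 3 k] by (simp add: c_def)
    have "(T * crt_mat) $$ (k, l) = (\<Sum>s = 0..<6. (if s = c then 1 else 0) *
        (if s = 3 * (l mod 2) + l mod 3 then 1 else 0))"
      using kl by (simp add: crt_mat_def T_def scalar_prod_def c_def)
    also have "\<dots> = (if c = 3 * (l mod 2) + l mod 3 then 1 else 0)"
      by (rule sum_indicator_mult(1)[OF c]) (rule refl)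
    also have "c = 3 * (l mod 2) + l mod 3 \<longleftrightarrow> k = l"
      using less_6_cases[OF kl(1)] less_6_cases[OF kl(2)] unfolding c_def by (elim insertE emptyE; simp)
    finally show "(T * crt_mat) $$ (k, l) = 1\<^sub>m 6 $$ (k, l)"
      using kl by (simp only: index_one_mat)
  qed (auto simp: crt_mat_def T_def)
  ultimately show ?thesis
    unfolding GL_carrier_iff by (intro conjI bexI[of _ T]) (auto simp: crt_mat_def T_def)
qed

text \<open>
  The permutation carries \<open>P\<^sub>6\<close> to \<open>P\<^sub>2 \<otimes> P\<^sub>3\<close> because \<open>k + 1\<close> has residues \<open>(k mod 2) + 1\<close> and
  \<open>(k mod 3) + 1\<close>. The second factor of \<open>W\<^sub>6\<close> is the square of \<open>W\<^sub>3\<close> because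
  \<open>k = 3 (k mod 2) + 4 (k mod 3)\<close> modulo 6, where \<open>\<omega>\<^sup>3 = - 1\<close>, and \<open>\<omega>\<^sup>4\<close> is the square of the
  standard cube root of unity \<open>\<omega>\<^sup>2\<close>.
\<close>

lemma crt_mat_weyl:
  "crt_mat * weyl_mat 6 a b = kronecker (weyl_mat 2 a b) (weyl_mat 3 a (2 * b)) * crt_mat"
proof (rule eq_matI)
  let ?K = "kronecker (weyl_mat 2 a b) (weyl_mat 3 a (2 * b))"
  have K: "?K \<in> carrier_mat 6 6"
    using kronecker_carrier[OF weyl_mat_carrier weyl_mat_carrier, of 2 a b 3 a "2 * b"] by simp
  then show "dim_row (crt_mat * weyl_mat 6 a b) = dim_row (?K * crt_mat)"
    "dim_col (crt_mat * weyl_mat 6 a b) = dim_col (?K * crt_mat)"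
    by (auto simp: crt_mat_def weyl_mat_def)
  fix s k assume "s < dim_row (?K * crt_mat)" "k < dim_col (?K * crt_mat)"
  then have sk: "s < 6" "k < 6" using K by (auto simp: crt_mat_def)
  let ?c = "(3 * (s div 3) + 4 * (s mod 3)) mod 6"
  define t where "t = 3 * (k mod 2) + k mod 3"
  have t: "t < 6" "t div 3 = k mod 2" "t mod 3 = k mod 3"
    using less_6_cases[OF sk(2)] unfolding t_def by (elim insertE emptyE; simp)+
  have "(crt_mat * weyl_mat 6 a b) $$ (s, k) =
      (\<Sum>l = 0..<6. (if s = 3 * (l mod 2) + l mod 3 then 1 else 0) * weyl_mat 6 a b $$ (l, k))"
    using sk by (simp add: crt_mat_def scalar_prod_def weyl_mat_def)
  also have "\<dots> = weyl_mat 6 a b $$ (?c, k)"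
    by (rule sum_indicator_mult(1)) (simp, simp only: crt_index_iff[OF sk(1)])
  also have "\<dots> = (if k = (?c + a) mod 6 then unity_root 6 ^ (b * k) else 0)"
    using sk by (simp add: weyl_mat_def)
  also have "\<dots> = (if k mod 2 = (s div 3 + a) mod 2 then unity_root 2 ^ (b * (k mod 2)) else 0) *
      (if k mod 3 = (s mod 3 + a) mod 3 then unity_root 3 ^ (2 * b * (k mod 3)) else 0)"
  proof -
    have "k = (?c + a) mod 6 \<longleftrightarrow> k mod 2 = (s div 3 + a) mod 2 \<and> k mod 3 = (s mod 3 + a) mod 3"
    proof -
      have "?c mod 2 = s div 3" "?c mod 3 = s mod 3"
        using less_6_cases[OF sk(1)] by (elim insertE emptyE; simp)+
      moreover have "(x + a) mod m = (y + a) mod m" if "x mod m = y" for x y m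
        using that mod_add_left_eq by metis
      ultimately have u: "(?c + a) mod 2 = (s div 3 + a) mod 2" "(?c + a) mod 3 = (s mod 3 + a) mod 3"
        by blast+
      have e: "k = r mod 6 \<longleftrightarrow> k mod 2 = r mod 2 \<and> k mod 3 = r mod 3" for r
      proof -
        have "k = x \<longleftrightarrow> k mod 2 = x mod 2 \<and> k mod 3 = x mod 3" if "x < 6" for x
          using less_6_cases[OF sk(2)] less_6_cases[OF that] by (elim insertE emptyE; simp)
        from this[of "r mod 6"] show ?thesis by (simp add: mod_mod_cancel)
      qed
      show ?thesis unfolding e[of "?c + a"] u by (rule refl)
    qed
    moreover have "unity_root 6 ^ (b * k) = unity_root 2 ^ (b * (k mod 2)) * unity_root 3 ^ (2 * b * (k mod 3))"
    proof -
      have r: "unity_root 2 = unity_root 6 ^ 3" "unity_root 3 = unity_root 6 ^ 2"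
        using unity_root_mult[of 3 2] unity_root_mult[of 2 3] by simp_all
      have "k mod 6 = (3 * (k mod 2) + 4 * (k mod 3)) mod 6"
        using less_6_cases[OF sk(2)] by (elim insertE emptyE; simp)
      then have "(b * k) mod 6 = (b * (3 * (k mod 2) + 4 * (k mod 3))) mod 6"
        by (rule mod_mult_cong[OF refl])
      also have "b * (3 * (k mod 2) + 4 * (k mod 3)) = 3 * (b * (k mod 2)) + 2 * (2 * b * (k mod 3))"
        by (simp add: distrib_left)
      finally have "unity_root 6 ^ (b * k) = unity_root 6 ^ (3 * (b * (k mod 2)) + 2 * (2 * b * (k mod 3)))"
        by (simp only: unity_root_power_eq_iff[of 6, simplified])
      then show ?thesis unfolding r by (simp only: power_add power_mult)
    qed
    ultimately show ?thesis by simp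
  qed
  also have "\<dots> = ?K $$ (s, t)"
    using sk t by (simp add: kronecker_index[of _ 2 _ 3] weyl_mat_def)
  also have "\<dots> = (\<Sum>u = 0..<6. ?K $$ (s, u) * (if u = t then 1 else 0))"
    by (rule sum_indicator_mult(2)[symmetric, OF t(1)]) (rule refl)
  also have "\<dots> = row ?K s \<bullet> col crt_mat k"
    unfolding scalar_prod_def
    by (rule sum.cong) (use sk K in \<open>auto simp: crt_mat_def t_def\<close>)
  also have "\<dots> = (?K * crt_mat) $$ (s, k)"
    by (rule index_mult_mat(1)[symmetric]) (use sk K in \<open>auto simp: crt_mat_def\<close>)
  finally show "(crt_mat * weyl_mat 6 a b) $$ (s, k) = (?K * crt_mat) $$ (s, k)" .
qed

lemma mat_2_cases: "i < 2 \<Longrightarrow> i = 0 \<or> i = (1::nat)" by auto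

lemma atLeastLessThan_0_2: "{0..<2} = {0, 1 :: nat}" by auto

text \<open>
  The hypothesis says that the pairs in \<open>L\<close> have pairwise vanishing determinant modulo 2. Hence modulo
  2 they are multiples of a single pair. Either this is \<open>(0, 1)\<close>, which gives diagonal matrices
  already, or it is \<open>(1, b0)\<close>, and then it is enough to diagonalize one antidiagonal matrix.
\<close>

lemma simultaneous_diagonalization_2:
  assumes L: "\<And>a b c d. (a, b) \<in> L \<Longrightarrow> (c, d) \<in> L \<Longrightarrow> (a * d) mod 2 = (b * c) mod 2"
  obtains q q' where "q \<in> carrier_mat 2 2" "q' \<in> carrier_mat 2 2" "q * q' = 1\<^sub>m 2" "q' * q = 1\<^sub>m 2"
    "\<And>a b. (a, b) \<in> L \<Longrightarrow> diagonal_mat (q * weyl_mat 2 a b * q')"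
proof (cases "\<exists>(a, b) \<in> L. odd a")
  case False
  have "diagonal_mat (1\<^sub>m 2 * weyl_mat 2 a b * 1\<^sub>m 2)" if "(a, b) \<in> L" for a b
  proof -
    have "even a" using that False by auto
    then have "(i + a) mod 2 = i" if "i < 2" for i using that by presburger
    then have "diagonal_mat (weyl_mat 2 a b)" by (auto simp: diagonal_mat_def weyl_mat_def)
    moreover have "1\<^sub>m 2 * weyl_mat 2 a b * 1\<^sub>m 2 = weyl_mat 2 a b"
      unfolding left_mult_one_mat[OF weyl_mat_carrier]
      by (rule right_mult_one_mat[OF weyl_mat_carrier])
    ultimately show ?thesis by simp
  qed
  then show ?thesis by (rule that[rotated 4]) simp_all
next
  case True
  then obtain a0 b0 where ab0: "(a0, b0) \<in> L" "odd a0" by auto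
  define \<epsilon> :: complex where "\<epsilon> = (if even b0 then 1 else - 1)"
  define l where "l = csqrt \<epsilon>"
  have l: "l * l = \<epsilon>" using power2_csqrt[of \<epsilon>] by (simp only: l_def power2_eq_square)
  then have l0: "l \<noteq> 0" by (auto simp: \<epsilon>_def split: if_splits)
  \<comment> \<open>The rows are left eigenvectors of the matrix with off-diagonal entries \<open>\<epsilon>\<close> and 1, for the
  eigenvalues \<open>l\<close> and \<open>- l\<close>.\<close>
  define q where "q = mat 2 2 (\<lambda>(i, j). if j = 0 then 1 else if i = 0 then l else - l)"
  define q' where "q' = mat 2 2 (\<lambda>(i, j). if i = 0 then 1 / 2 else if j = 0 then 1 / (2 * l) else - 1 / (2 * l))"
  have inv: "q * q' = 1\<^sub>m 2" "q' * q = 1\<^sub>m 2"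
    by (rule eq_matI; use l0 in \<open>auto simp: q_def q'_def scalar_prod_def atLeastLessThan_0_2 dest!: mat_2_cases\<close>)+
  have w: "weyl_mat 2 1 b0 = mat 2 2 (\<lambda>(i, j). if i = j then 0 else if i = 0 then \<epsilon> else 1)"
    by (rule eq_matI) (auto simp: weyl_mat_def \<epsilon>_def unity_root_def dest!: mat_2_cases)
  define D where "D = mat 2 2 (\<lambda>(i, j). if i = j then if i = 0 then l else - l else 0)"
  have carr: "q \<in> carrier_mat 2 2" "q' \<in> carrier_mat 2 2" "D \<in> carrier_mat 2 2"
    by (simp_all add: q_def q'_def D_def)
  have "q * weyl_mat 2 1 b0 = D * q"
    unfolding w
    by (rule eq_matI) (use l in \<open>auto simp: q_def D_def scalar_prod_def atLeastLessThan_0_2 dest!: mat_2_cases\<close>)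
  then have "q * weyl_mat 2 1 b0 * q' = D"
    by (simp only: assoc_mult_mat[OF carr(3,1,2)] inv(1) right_mult_one_mat[OF carr(3)])
  moreover have "diagonal_mat D" by (simp add: diagonal_mat_def D_def)
  ultimately have one: "diagonal_mat (q * weyl_mat 2 1 b0 * q')" by simp
  have zero: "diagonal_mat (q * weyl_mat 2 0 0 * q')"
    unfolding weyl_mat_0_0 using inv by (simp add: q_def diagonal_mat_def)
  have "diagonal_mat (q * weyl_mat 2 a b * q')" if ab: "(a, b) \<in> L" for a b
  proof -
    have "even (a * b0) \<longleftrightarrow> even (b * a0)"
      using L[OF ab ab0(1)] by (simp only: even_iff_mod_2_eq_zero)
    then have parity: "even a \<or> even b0 \<longleftrightarrow> even b" using ab0(2) by simp
    show ?thesis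
    proof (cases "even a")
      case True
      then have "weyl_mat 2 a b = weyl_mat 2 0 0"
        using parity by (intro weyl_mat_cong) simp_all
      then show ?thesis using zero by simp
    next
      case False
      then have "even b \<longleftrightarrow> even b0" using parity by simp
      then have "b mod 2 = b0 mod 2"
        by (simp add: mod2_eq_if)
      moreover have "a mod 2 = 1 mod 2" using False by (simp add: mod2_eq_if)
      ultimately have "weyl_mat 2 a b = weyl_mat 2 1 b0"
        by (intro weyl_mat_cong) simp_all
      then show ?thesis using one by simp
    qed
  qed
  then show ?thesis by (rule that[OF carr(1,2) inv])
qed

lemma (in group) conjugate_eqI:
  assumes "x \<otimes> y = z \<otimes> x" "x \<in> carrier G" "z \<in> carrier G"
  shows "x \<otimes> y \<otimes> inv x = z"
  unfolding assms(1) m_assoc[OF assms(3,2) inv_closed[OF assms(2)]] using assms(2,3) by simp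

text \<open>
  The conjugating matrix is \<open>(q \<otimes> 1)\<close> times the Chinese remainder permutation, where \<open>q\<close> diagonalizes
  all the \<open>2 \<times> 2\<close> tensor factors.
\<close>

lemma weyl_tensor_form:
  assumes L: "\<And>a b c d. (a, b) \<in> L \<Longrightarrow> (c, d) \<in> L \<Longrightarrow> (a * d) mod 2 = (b * c) mod 2"
  obtains h where "h \<in> carrier (PGL 6)"
    "\<And>a b. (a, b) \<in> L \<Longrightarrow> h \<otimes>\<^bsub>PGL 6\<^esub> weyl_class 6 a b \<otimes>\<^bsub>PGL 6\<^esub> inv\<^bsub>PGL 6\<^esub> h
       \<in> tensor_group 2 3 (diag_group 2) (pauli 3)"
proof -
  interpret group "PGL 6" by (rule PGL_group)
  obtain q q' where q: "q \<in> carrier_mat 2 2" "q' \<in> carrier_mat 2 2" "q * q' = 1\<^sub>m 2" "q' * q = 1\<^sub>m 2"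
    "\<And>a b. (a, b) \<in> L \<Longrightarrow> diagonal_mat (q * weyl_mat 2 a b * q')"
    by (rule simultaneous_diagonalization_2[where L = L, OF L]) blast+
  define T where "T = kronecker q (1\<^sub>m 3)"
  have qG: "q \<in> carrier (GL 2)" "q' \<in> carrier (GL 2)"
    unfolding GL_carrier_iff using q by blast+
  have "1\<^sub>m 3 \<in> carrier (GL 3)"
    unfolding GL_carrier_iff by (intro conjI bexI[of _ "1\<^sub>m 3"]) auto
  then have T: "T \<in> carrier (GL 6)"
    using kronecker_GL[OF qG(1), of "1\<^sub>m 3" 3] by (simp add: T_def)
  let ?H = "T * crt_mat"
  have H: "?H \<in> carrier (GL 6)"
    by (rule GL_closed[OF T crt_mat_GL])
  show ?thesis
  proof (rule that)
    show h: "pgl_class 6 ?H \<in> carrier (PGL 6)" unfolding PGL_carrier by (rule imageI[OF H])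
    fix a b assume ab: "(a, b) \<in> L"
    let ?W2 = "weyl_mat 2 a b" and ?W3 = "weyl_mat 3 a (2 * b)"
    let ?D = "q * ?W2 * q'"
    have W2: "?W2 \<in> carrier (GL 2)" and W3: "?W3 \<in> carrier (GL 3)" and W6: "weyl_mat 6 a b \<in> carrier (GL 6)"
      by (simp_all add: weyl_mat_GL)
    have D: "?D \<in> carrier (GL 2)"
      by (intro GL_closed qG W2)
    have K: "kronecker ?D ?W3 \<in> carrier (GL 6)"
      using kronecker_GL[OF D W3] by simp
    have Dq: "?D * q = q * ?W2"
    proof -
      have "?D * q = q * ?W2 * (q' * q)"
        by (rule assoc_mult_mat[OF mult_carrier_mat[OF q(1) weyl_mat_carrier] q(2,1)])
      then show ?thesis
        unfolding q(4) right_mult_one_mat[OF mult_carrier_mat[OF q(1) weyl_mat_carrier]] .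
    qed
    have "T * kronecker ?W2 ?W3 = kronecker (q * ?W2) ?W3"
      unfolding T_def kronecker_mult[OF q(1) weyl_mat_carrier one_carrier_mat weyl_mat_carrier]
        left_mult_one_mat[OF weyl_mat_carrier] ..
    also have "\<dots> = kronecker ?D ?W3 * T"
      unfolding T_def kronecker_mult[OF GL_carrierD[OF D] q(1) weyl_mat_carrier one_carrier_mat]
        right_mult_one_mat[OF weyl_mat_carrier] Dq ..
    finally have "T * kronecker ?W2 ?W3 = kronecker ?D ?W3 * T" .
    then have "?H * weyl_mat 6 a b = kronecker ?D ?W3 * ?H"
    proof -
      assume eq: "T * kronecker ?W2 ?W3 = kronecker ?D ?W3 * T"
      have c: "T \<in> carrier_mat 6 6" "crt_mat \<in> carrier_mat 6 6" "kronecker ?D ?W3 \<in> carrier_mat 6 6"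
        "kronecker ?W2 ?W3 \<in> carrier_mat 6 6"
        using T crt_mat_GL K kronecker_GL[OF W2 W3] by (auto dest: GL_carrierD)
      have "?H * weyl_mat 6 a b = T * (crt_mat * weyl_mat 6 a b)"
        by (rule assoc_mult_mat[OF c(1,2) weyl_mat_carrier])
      also have "\<dots> = T * kronecker ?W2 ?W3 * crt_mat"
        unfolding crt_mat_weyl by (rule assoc_mult_mat[OF c(1,4,2), symmetric])
      also have "\<dots> = kronecker ?D ?W3 * ?H"
        unfolding eq by (rule assoc_mult_mat[OF c(3,1,2)])
      finally show ?thesis .
    qed
    then have "pgl_class 6 ?H \<otimes>\<^bsub>PGL 6\<^esub> weyl_class 6 a b
        = pgl_class 6 (kronecker ?D ?W3) \<otimes>\<^bsub>PGL 6\<^esub> pgl_class 6 ?H"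
      by (simp only: pgl_class_mult[OF H W6] pgl_class_mult[OF K H])
    moreover have "pgl_class 6 (kronecker ?D ?W3) \<in> carrier (PGL 6)"
      unfolding PGL_carrier by (rule imageI[OF K])
    ultimately have "pgl_class 6 ?H \<otimes>\<^bsub>PGL 6\<^esub> weyl_class 6 a b \<otimes>\<^bsub>PGL 6\<^esub> inv\<^bsub>PGL 6\<^esub> pgl_class 6 ?H
        = pgl_class 6 (kronecker ?D ?W3)"
      by (intro conjugate_eqI h)
    moreover have "pgl_class 6 (kronecker ?D ?W3) \<in> tensor_group 2 3 (diag_group 2) (pauli 3)"
    proof -
      have "pgl_class 2 ?D \<in> diag_group 2" using D q(5)[OF ab] by (auto simp: diag_group_def)
      moreover have "pgl_class 3 ?W3 \<in> pauli 3" by (auto simp: pauli_eq)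
      ultimately have "pgl_class (2 * 3) (kronecker ?D ?W3) \<in> tensor_group 2 3 (diag_group 2) (pauli 3)"
        unfolding tensor_group_def using D W3 by blast
      then show ?thesis by simp
    qed
    ultimately show "pgl_class 6 ?H \<otimes>\<^bsub>PGL 6\<^esub> weyl_class 6 a b \<otimes>\<^bsub>PGL 6\<^esub> inv\<^bsub>PGL 6\<^esub> pgl_class 6 ?H
       \<in> tensor_group 2 3 (diag_group 2) (pauli 3)" by (simp only:)
  qed
qed

section \<open>Pauli symmetries of smooth cubic fourfolds\<close>

lemma (in group) conjugate_to_subgroup_ofI:
  assumes K: "subgroup K G" and h: "h \<in> carrier G"
    and S: "\<And>x. x \<in> K \<Longrightarrow> h \<otimes> x \<otimes> inv h \<in> S"
  shows "conjugate_to_subgroup_of G K S"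
proof -
  have conj: "(h \<otimes> x \<otimes> inv h) \<otimes> (h \<otimes> y \<otimes> inv h) = h \<otimes> (x \<otimes> y) \<otimes> inv h"
    if "x \<in> carrier G" "y \<in> carrier G" for x y
  proof -
    have "inv h \<otimes> (h \<otimes> (y \<otimes> inv h)) = y \<otimes> inv h"
      using that h by (simp add: m_assoc[symmetric])
    then show ?thesis using that h by (simp add: m_assoc)
  qed
  have "(\<lambda>x. h \<otimes> x \<otimes> inv h) \<in> hom G G"
    by (rule homI) (use h conj in auto)
  then have "group_hom G G (\<lambda>x. h \<otimes> x \<otimes> inv h)"
    by (simp add: group_hom_def group_hom_axioms_def is_group)
  then have "subgroup ((\<lambda>x. h \<otimes> x \<otimes> inv h) ` K) G"
    by (rule group_hom.subgroup_img_is_subgroup[OF _ K])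
  then show ?thesis
    unfolding conjugate_to_subgroup_of_def conjugate_in_def using h S by blast
qed

lemma smult_mult_mat_vec:
  "A \<in> carrier_mat n n \<Longrightarrow> v \<in> carrier_vec n \<Longrightarrow> (c \<cdot>\<^sub>m A) *\<^sub>v v = c \<cdot>\<^sub>v (A *\<^sub>v (v :: complex vec))"
  by (intro eq_vecI) auto

lemma pgl_act_preserves_zeros:
  assumes F: "homogeneous_form n 3 F" and A: "A \<in> carrier_mat n n"
    and act: "pgl_act (pgl_class n A) ` proj_zeros n F \<subseteq> proj_zeros n F"
    and v: "v \<in> carrier_vec n" "eval_cpoly F v = 0"
  shows "eval_cpoly F (A *\<^sub>v v) = 0"
proof (cases "v = 0\<^sub>v n")
  case True
  moreover have "A *\<^sub>v 0\<^sub>v n = 0\<^sub>v n" using A by (intro eq_vecI) auto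
  ultimately show ?thesis using v by simp
next
  case False
  then have "proj_point v \<in> proj_zeros n F" using v by (auto simp: proj_zeros_def)
  then have "pgl_act (pgl_class n A) (proj_point v) \<in> proj_zeros n F" using act by blast
  then obtain w where w: "w \<in> carrier_vec n" "eval_cpoly F w = 0"
    "pgl_act (pgl_class n A) (proj_point v) = proj_point w" by (auto simp: proj_zeros_def)
  have "A \<in> pgl_class n A"
    unfolding pgl_class_eq[OF A] by (intro CollectI exI[of _ 1]) (simp add: one_smult_mat)
  moreover have "v \<in> proj_point v"
    unfolding proj_point_def by (intro CollectI exI[of _ 1]) simp
  ultimately have "A *\<^sub>v v \<in> proj_point w"
    unfolding w(3)[symmetric] pgl_act_def by blast
  then obtain c where "A *\<^sub>v v = c \<cdot>\<^sub>v w" by (auto simp: proj_point_def)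
  then show ?thesis using cubic_smult[OF F w(1)] w(2) by simp
qed

text \<open>
  Both \<open>A B\<close> and \<open>B A\<close> multiply \<open>F\<close> by the product of the nonzero factors of \<open>A\<close> and \<open>B\<close>, while a
  scalar \<open>\<alpha>\<close> multiplies the cubic form \<open>F\<close> by its cube.
\<close>

lemma commutation_scalars_cubed:
  assumes F: "homogeneous_form n 3 F" and sm: "smooth_form n F" and n: "3 \<le> n"
    and A: "A \<in> carrier (GL n)" and B: "B \<in> carrier (GL n)"
    and comm: "\<alpha> \<cdot>\<^sub>m (A * B) = \<beta> \<cdot>\<^sub>m (B * A)"
    and zA: "\<And>v. v \<in> carrier_vec n \<Longrightarrow> eval_cpoly F v = 0 \<Longrightarrow> eval_cpoly F (A *\<^sub>v v) = 0"
    and zB: "\<And>v. v \<in> carrier_vec n \<Longrightarrow> eval_cpoly F v = 0 \<Longrightarrow> eval_cpoly F (B *\<^sub>v v) = 0"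
  shows "\<alpha> ^ 3 = \<beta> ^ 3"
proof -
  let ?f = "eval_cpoly F"
  have nonzero: "c \<noteq> 0" if M: "M \<in> carrier (GL n)"
    and c: "\<And>v. v \<in> carrier_vec n \<Longrightarrow> ?f (M *\<^sub>v v) = c * ?f v" for M c
  proof
    assume "c = 0"
    obtain b where b: "b \<in> carrier_vec n" "?f b \<noteq> 0"
      using smooth_cubic_nonvanishing[OF F sm] n by auto
    obtain N where N: "N \<in> carrier (GL n)" "M * N = 1\<^sub>m n" using GL_inverse[OF M] by metis
    have Nb: "N *\<^sub>v b \<in> carrier_vec n" using GL_carrierD[OF N(1)] b(1) by (rule mult_mat_vec_carrier)
    have "b = M *\<^sub>v (N *\<^sub>v b)"
      using assoc_mult_mat_vec[OF GL_carrierD[OF M] GL_carrierD[OF N(1)] b(1)] N(2) b(1) by simp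
    then show False using c[OF Nb] b(2) \<open>c = 0\<close> by simp
  qed
  note Ac = GL_carrierD[OF A] and Bc = GL_carrierD[OF B]
  obtain cA where cA: "\<And>v. v \<in> carrier_vec n \<Longrightarrow> ?f (A *\<^sub>v v) = cA * ?f v"
    using smooth_cubic_semi_invariant[OF F sm n Ac zA] by blast
  obtain cB where cB: "\<And>v. v \<in> carrier_vec n \<Longrightarrow> ?f (B *\<^sub>v v) = cB * ?f v"
    using smooth_cubic_semi_invariant[OF F sm n Bc zB] by blast
  obtain b where b: "b \<in> carrier_vec n" "?f b \<noteq> 0"
    using smooth_cubic_nonvanishing[OF F sm] n by auto
  have eval: "?f ((c \<cdot>\<^sub>m (M * N)) *\<^sub>v b) = c ^ 3 * ?f (M *\<^sub>v (N *\<^sub>v b))"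
    if M: "M \<in> carrier_mat n n" and N: "N \<in> carrier_mat n n" for c M N
  proof -
    have "(c \<cdot>\<^sub>m (M * N)) *\<^sub>v b = c \<cdot>\<^sub>v (M *\<^sub>v (N *\<^sub>v b))"
      using smult_mult_mat_vec[OF mult_carrier_mat[OF M N] b(1)] assoc_mult_mat_vec[OF M N b(1)] by simp
    moreover have "M *\<^sub>v (N *\<^sub>v b) \<in> carrier_vec n"
      by (intro mult_mat_vec_carrier[OF M] mult_mat_vec_carrier[OF N] b)
    ultimately show ?thesis using cubic_smult[OF F] by simp
  qed
  have "\<alpha> ^ 3 * (cA * (cB * ?f b)) = ?f ((\<alpha> \<cdot>\<^sub>m (A * B)) *\<^sub>v b)"
    unfolding eval[OF Ac Bc] using cA[OF mult_mat_vec_carrier[OF Bc b(1)]] cB[OF b(1)] by simp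
  also have "\<dots> = \<beta> ^ 3 * (cB * (cA * ?f b))"
    unfolding comm eval[OF Bc Ac] using cB[OF mult_mat_vec_carrier[OF Ac b(1)]] cA[OF b(1)] by simp
  finally show ?thesis
    using nonzero[OF A cA] nonzero[OF B cB] b(2) by simp
qed

text \<open>
  Two elements of the Pauli group commute up to the power \<open>a d - b c\<close> of a primitive sixth root of unity.
  Its cube must be 1, which leaves exactly the even exponents. The set \<open>L\<close> collects the exponents of the
  elements that act on the cubic after conjugation by \<open>k\<close>.
\<close>

lemma pauli_6_commutation_parity:
  assumes X: "smooth_cubic_hypersurface 6 X" and k: "k \<in> carrier (GL 6)" "k' \<in> carrier (GL 6)"
      "k * k' = 1\<^sub>m 6"
    and act: "\<And>a b. (a, b) \<in> L \<Longrightarrow> pgl_act (pgl_class 6 (k' * weyl_mat 6 a b * k)) ` X \<subseteq> X"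
    and ab: "(a, b) \<in> L" and cd: "(c, d) \<in> L"
  shows "(a * d) mod 2 = (b * c) mod 2"
proof -
  obtain F where F: "homogeneous_form 6 3 F" "smooth_form 6 F" "X = proj_zeros 6 F"
    using X by (auto simp: smooth_cubic_hypersurface_def)
  let ?w = "unity_root 6"
  define M where "M a b = k' * weyl_mat 6 a b * k" for a b
  note kc = GL_carrierD[OF k(1)] GL_carrierD[OF k(2)]
  have M: "M a b \<in> carrier (GL 6)" for a b
    unfolding M_def by (intro GL_closed k weyl_mat_GL) simp
  have MM: "s \<cdot>\<^sub>m (M a b * M c d) = k' * (s \<cdot>\<^sub>m (weyl_mat 6 a b * weyl_mat 6 c d)) * k" for s a b c d
  proof -
    let ?A = "weyl_mat 6 a b" and ?B = "weyl_mat 6 c d"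
    have A: "?A \<in> carrier_mat 6 6" "?B \<in> carrier_mat 6 6" by simp_all
    have AB: "?A * ?B \<in> carrier_mat 6 6" by (rule mult_carrier_mat[OF A])
    have kB: "k' * ?B * k \<in> carrier_mat 6 6"
      by (intro mult_carrier_mat[of _ 6 6] kc A)
    have "k * (k' * ?B * k) = k * k' * (?B * k)"
      using assoc_mult_mat[OF kc mult_carrier_mat[OF A(2) kc(1)]] assoc_mult_mat[OF kc(2) A(2) kc(1)] by simp
    also have "\<dots> = ?B * k"
      unfolding k(3) by (rule left_mult_one_mat[OF mult_carrier_mat[OF A(2) kc(1)]])
    finally have e: "k * (k' * ?B * k) = ?B * k" .
    have "M a b * M c d = k' * ?A * (k * (k' * ?B * k))"
      unfolding M_def by (rule assoc_mult_mat[OF mult_carrier_mat[OF kc(2) A(1)] kc(1) kB])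
    also have "\<dots> = k' * (?A * ?B) * k"
      unfolding e using assoc_mult_mat[OF mult_carrier_mat[OF kc(2) A(1)] A(2) kc(1)]
        assoc_mult_mat[OF kc(2) A] by simp
    finally show ?thesis
      using mult_smult_distrib[OF kc(2) AB] mult_smult_assoc_mat[OF mult_carrier_mat[OF kc(2) AB] kc(1)]
      by simp
  qed
  have "?w ^ (b * c) \<cdot>\<^sub>m (M a b * M c d) = ?w ^ (d * a) \<cdot>\<^sub>m (M c d * M a b)"
    unfolding MM weyl_mat_mult[of 6, simplified] by (simp add: add.commute)
  moreover have zeros: "eval_cpoly F (M a b *\<^sub>v v) = 0"
    if "(a, b) \<in> L" "v \<in> carrier_vec 6" "eval_cpoly F v = 0" for a b v
    using pgl_act_preserves_zeros[OF F(1) GL_carrierD[OF M] _ that(2,3)] act[OF that(1)]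
    unfolding F(3) M_def by blast
  ultimately have "(?w ^ (b * c)) ^ 3 = (?w ^ (d * a)) ^ 3"
    using ab cd by (intro commutation_scalars_cubed[OF F(1,2) _ M M]) auto
  then have "?w ^ (b * c * 3) = ?w ^ (d * a * 3)"
    by (simp only: power_mult)
  then have "(b * c * 3) mod 6 = (d * a * 3) mod 6"
    by (simp only: unity_root_power_eq_iff[of 6, simplified])
  then have "(b * c) mod 2 = (d * a) mod 2"
    using mult_mod_left[of "b * c" 2 3] mult_mod_left[of "d * a" 2 3] by simp
  then show ?thesis by (simp add: mult.commute)
qed

theorem theorem4:
  fixes G :: "complex mat set set"
  assumes "cubic_fourfold_automorphism_group G"
    and "comm_group ((PGL 6)\<lparr>carrier := G\<rparr>)"
    and "conjugate_to_subgroup_of (PGL 6) G (pauli 6)"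
  shows "(diagonalizable 6 G
        \<or> conjugate_to_subgroup_of (PGL 6) G (tensor_group 3 2 (diag_group 3) (pauli 2))
        \<or> conjugate_to_subgroup_of (PGL 6) G (tensor_group 2 3 (diag_group 2) (pauli 3))
        \<or> (\<exists>i \<in> {0, 1}. conjugate_in (PGL 6) G (pauli_subgroup_36 i)))
    \<and> (\<forall>i \<in> {0, 1}. pauli_subgroup_36 i \<subseteq> pauli 6
        \<and> (PGL 6)\<lparr>carrier := pauli_subgroup_36 i\<rparr> \<cong> integer_mod_group 3 \<times>\<times> integer_mod_group 6)"
proof -
  interpret group "PGL 6" by (rule PGL_group)
  obtain X where X: "smooth_cubic_hypersurface 6 X" and act: "\<And>g. g \<in> G \<Longrightarrow> pgl_act g ` X \<subseteq> X"
    and G: "subgroup G (PGL 6)"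
    using assms(1) by (auto simp: cubic_fourfold_automorphism_group_def)
  obtain x where x: "x \<in> carrier (PGL 6)"
    and sub: "(\<lambda>g. x \<otimes>\<^bsub>PGL 6\<^esub> g \<otimes>\<^bsub>PGL 6\<^esub> inv\<^bsub>PGL 6\<^esub> x) ` G \<subseteq> pauli 6"
    using assms(3) by (auto simp: conjugate_to_subgroup_of_def conjugate_in_def)
  obtain k where k: "k \<in> carrier (GL 6)" "x = pgl_class 6 k" using x by (auto simp: PGL_carrier)
  obtain k' where k': "k' \<in> carrier (GL 6)" "k * k' = 1\<^sub>m 6" "k' * k = 1\<^sub>m 6"
    using GL_inverse[OF k(1)] by metis
  have inv: "inv\<^bsub>PGL 6\<^esub> x = pgl_class 6 k'"
    unfolding k(2)
  proof (rule inv_equality)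
    show "pgl_class 6 k' \<otimes>\<^bsub>PGL 6\<^esub> pgl_class 6 k = \<one>\<^bsub>PGL 6\<^esub>"
      unfolding pgl_class_mult[OF k'(1) k(1)] k'(3) by (rule pgl_class_one)
    show "pgl_class 6 k \<in> carrier (PGL 6)" "pgl_class 6 k' \<in> carrier (PGL 6)"
      unfolding PGL_carrier by (rule imageI[OF k(1)], rule imageI[OF k'(1)])
  qed
  define L where "L = {(a, b). \<exists>g\<in>G. x \<otimes>\<^bsub>PGL 6\<^esub> g \<otimes>\<^bsub>PGL 6\<^esub> inv\<^bsub>PGL 6\<^esub> x = weyl_class 6 a b}"
  have actL: "pgl_act (pgl_class 6 (k' * weyl_mat 6 a b * k)) ` X \<subseteq> X" if ab: "(a, b) \<in> L" for a b
  proof -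
    obtain g where g: "g \<in> G" "x \<otimes>\<^bsub>PGL 6\<^esub> g \<otimes>\<^bsub>PGL 6\<^esub> inv\<^bsub>PGL 6\<^esub> x = weyl_class 6 a b"
      using ab by (auto simp: L_def)
    have gc: "g \<in> carrier (PGL 6)" using g(1) subgroup.mem_carrier[OF G] by blast
    have W: "weyl_mat 6 a b \<in> carrier (GL 6)" by (simp add: weyl_mat_GL)
    have "pgl_class 6 (k' * weyl_mat 6 a b * k)
        = inv\<^bsub>PGL 6\<^esub> x \<otimes>\<^bsub>PGL 6\<^esub> weyl_class 6 a b \<otimes>\<^bsub>PGL 6\<^esub> x"
      unfolding inv unfolding k(2) using pgl_class_mult[OF k'(1) W] pgl_class_mult[OF GL_closed[OF k'(1) W] k(1)]
      by (simp only:)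
    also have "\<dots> = inv\<^bsub>PGL 6\<^esub> x \<otimes>\<^bsub>PGL 6\<^esub> (x \<otimes>\<^bsub>PGL 6\<^esub> g)"
      unfolding g(2)[symmetric] using x gc by (simp add: m_assoc)
    also have "\<dots> = g" using x gc by (simp add: m_assoc[symmetric])
    finally show ?thesis using act[OF g(1)] by (simp only:)
  qed
  have parity: "(a * d) mod 2 = (b * c) mod 2" if "(a, b) \<in> L" "(c, d) \<in> L" for a b c d
    by (rule pauli_6_commutation_parity[OF X k(1) k'(1,2) actL that])
  obtain h where h: "h \<in> carrier (PGL 6)"
    "\<And>a b. (a, b) \<in> L \<Longrightarrow> h \<otimes>\<^bsub>PGL 6\<^esub> weyl_class 6 a b \<otimes>\<^bsub>PGL 6\<^esub> inv\<^bsub>PGL 6\<^esub> h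
       \<in> tensor_group 2 3 (diag_group 2) (pauli 3)"
    by (rule weyl_tensor_form[where L = L, OF parity]) blast+
  have "conjugate_to_subgroup_of (PGL 6) G (tensor_group 2 3 (diag_group 2) (pauli 3))"
  proof (rule conjugate_to_subgroup_ofI[OF G])
    show "h \<otimes>\<^bsub>PGL 6\<^esub> x \<in> carrier (PGL 6)" using h(1) x by simp
    fix g assume g: "g \<in> G"
    then have gc: "g \<in> carrier (PGL 6)" using subgroup.mem_carrier[OF G] by blast
    obtain a b where ab: "x \<otimes>\<^bsub>PGL 6\<^esub> g \<otimes>\<^bsub>PGL 6\<^esub> inv\<^bsub>PGL 6\<^esub> x = weyl_class 6 a b"
      using sub g by (auto simp: pauli_eq)
    then have "(a, b) \<in> L" using g by (auto simp: L_def)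
    moreover have "(h \<otimes>\<^bsub>PGL 6\<^esub> x) \<otimes>\<^bsub>PGL 6\<^esub> g \<otimes>\<^bsub>PGL 6\<^esub> inv\<^bsub>PGL 6\<^esub> (h \<otimes>\<^bsub>PGL 6\<^esub> x)
        = h \<otimes>\<^bsub>PGL 6\<^esub> weyl_class 6 a b \<otimes>\<^bsub>PGL 6\<^esub> inv\<^bsub>PGL 6\<^esub> h"
      unfolding ab[symmetric] using h(1) x gc by (simp add: m_assoc inv_mult_group)
    ultimately show "(h \<otimes>\<^bsub>PGL 6\<^esub> x) \<otimes>\<^bsub>PGL 6\<^esub> g \<otimes>\<^bsub>PGL 6\<^esub> inv\<^bsub>PGL 6\<^esub> (h \<otimes>\<^bsub>PGL 6\<^esub> x)
        \<in> tensor_group 2 3 (diag_group 2) (pauli 3)"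
      using h(2) by simp
  qed
  moreover have "pauli_subgroup_36 i \<subseteq> pauli 6" for i
    by (auto simp: pauli_subgroup_36_eq pauli_eq)
  ultimately show ?thesis using pauli_subgroup_36_iso by blast
qed

end
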